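(* Let $n\geq4$. An even symmetric $n$-ary octic $f\in H_{n,8}^{B_n}$ is a sum of squares if and only if there exist positive semidefinite matrices $A_1,A_2,A_4\in\mathbb{R}^{2\times2}$ and non-negative real numbers $A_3,A_5,A_6,A_7$ such that $$f=\langle A_1,B_1\rangle+\langle A_2,B_2\rangle+A_3B_3+\langle A_4,B_4\rangle+A_5B_5+A_6B_6+A_7B_7,$$ where, writing $p_\lambda=p_\lambda^{(n)}$, \begin{align*} B_1&=\begin{pmatrix} p_{(4^2)} & p_{(4,2^2)} \\ {p_{(4,2^2)}} & p_{(2^4)} \end{pmatrix},\\ B_2&=\begin{pmatrix} p_{(4,2^2)}-p_{(2^4)} & p_{(6,2)}-p_{(4,2^2)} \\ {p_{(6,2)}}-p_{(4,2^2)} & p_{(8)}-p_{(4^2)} \end{pmatrix},\\ B_3&=\tfrac{-n+1}{n^2}p_{(8)}+\tfrac{4n-4}{n^2}p_{(6,2)}+\tfrac{n^2-3n+3}{n^2}p_{(4^2)}-2p_{(4,2^2)}+p_{(2^4)},\\ B_4&=\begin{pmatrix} p_{(2^4)}-\frac1n p_{(4,2^2)} & 2p_{(4,2^2)}-\frac2n p_{(6,2)} \\ 2p_{(4,2^2)}-\frac2n p_{(6,2)} & 2p_{(6,2)}+2p_{(4^2)}-\frac4n p_{(8)} \end{pmatrix},\\ B_5&=p_{(6,2)}-p_{(4^2)},\\ B_6&=p_{(2^4)}-\tfrac6n p_{(4,2^2)}+\tfrac3{n^2}p_{(4^2)}+\tfrac8{n^2}p_{(6,2)}-\tfrac6{n^3}p_{(8)},\\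 B_7&=\tfrac2{n^2}p_{(8)}-\tfrac{2n+2}{n^2}p_{(6,2)}-\tfrac1n p_{(4^2)}+\tfrac{n+3}{n}p_{(4,2^2)}-p_{(2^4)}. \end{align*}
   Context: $B_n$ is the group of all coordinate permutations and sign changes on $\mathbb{R}^n$, and $H_{n,8}^{B_n}$ is the space of $B_n$-invariant real forms of degree 8 in $X_1,\ldots,X_n$. The power means are $p_i^{(n)}=\frac1n\sum_{j=1}^nX_j^i$, and for a partition $\lambda=(\lambda_1,\ldots,\lambda_l)$, $p_\lambda^{(n)}=p_{\lambda_1}^{(n)}\cdots p_{\lambda_l}^{(n)}$; exponents abbreviate repetition, e.g. $(4,2^2)=(4,2,2)$, $(2^4)=(2,2,2,2)$, $(4^2)=(4,4)$. For symmetric matrices, $\langle A,B\rangle=\operatorname{trace}(AB)$. A form is a sum of squares if it is a finite sum of squares of real forms. *)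

theory Defs
  imports "HOL-Analysis.Analysis" "HOL-Library.Poly_Mapping"
begin

text \<open>
  Real polynomials in the variables \<open>X\<^sub>i\<close>, where \<open>i\<close> ranges over a finite type \<open>'n\<close> with
  \<open>n = CARD('n)\<close> elements: finitely supported maps from monomials to coefficients, a monomial
  being its exponent vector.
\<close>
type_synonym 'n mpoly = "('n \<Rightarrow>\<^sub>0 nat) \<Rightarrow>\<^sub>0 real"

definition Const :: "real \<Rightarrow> 'n mpoly" where
  "Const c = Poly_Mapping.single 0 c"

definition X :: "'n \<Rightarrow> 'n mpoly" where
  "X i = Poly_Mapping.single (Poly_Mapping.single i 1) 1"

definition homogeneous :: "nat \<Rightarrow> ('n::finite) mpoly \<Rightarrow> bool" where
  "homogeneous d f \<longleftrightarrow>
     (\<forall>m\<in>Poly_Mapping.keys f. (\<Sum>i\<in>UNIV. Poly_Mapping.lookup m i) = d)"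

definition form :: "('n::finite) mpoly \<Rightarrow> bool" where
  "form f \<longleftrightarrow> (\<exists>d. homogeneous d f)"

definition sum_of_squares :: "('n::finite) mpoly \<Rightarrow> bool" where
  "sum_of_squares f \<longleftrightarrow> (\<exists>gs. (\<forall>g\<in>set gs. form g) \<and> f = (\<Sum>g\<leftarrow>gs. g ^ 2))"

text \<open>The polynomial obtained from \<open>f\<close> by substituting \<open>s i\<close> for every variable \<open>X\<^sub>i\<close>.\<close>
definition subst :: "('n::finite \<Rightarrow> 'n mpoly) \<Rightarrow> 'n mpoly \<Rightarrow> 'n mpoly" where
  "subst s f = (\<Sum>m\<in>Poly_Mapping.keys f.
     Const (Poly_Mapping.lookup f m) * (\<Prod>i\<in>UNIV. s i ^ Poly_Mapping.lookup m i))"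

text \<open>
  The elements of \<open>B\<^sub>n\<close>: the pair \<open>(\<sigma>, \<epsilon>)\<close> stands for the signed coordinate permutation
  acting on polynomials by \<open>X\<^sub>i \<mapsto> \<epsilon>\<^sub>i X\<^bsub>\<sigma>(i)\<^esub>\<close>.
\<close>
definition signed_perms :: "(('n::finite \<Rightarrow> 'n) \<times> ('n \<Rightarrow> real)) set" where
  "signed_perms = {(\<sigma>, \<epsilon>). bij \<sigma> \<and> (\<forall>i. \<epsilon> i \<in> {1, -1})}"

text \<open>The space \<open>H\<close> of \<open>B\<^sub>n\<close>-invariant forms of degree \<open>d\<close>, including the zero form.\<close>
definition even_symmetric_forms :: "nat \<Rightarrow> ('n::finite) mpoly set" where
  "even_symmetric_forms d = {f. homogeneous d f \<and>
     (\<forall>(\<sigma>, \<epsilon>)\<in>signed_perms. subst (\<lambda>i. Const (\<epsilon> i) * X (\<sigma> i)) f = f)}"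

definition power_mean :: "nat \<Rightarrow> ('n::finite) mpoly" where
  "power_mean k = Const (1 / real CARD('n)) * (\<Sum>j\<in>UNIV. X j ^ k)"

text \<open>\<open>p\<^sub>\<lambda>\<close> for a partition \<open>\<lambda>\<close>, given as the list of its parts.\<close>
definition p :: "nat list \<Rightarrow> ('n::finite) mpoly" where
  "p l = prod_list (map power_mean l)"

definition psd :: "real ^ 'k ^ 'k \<Rightarrow> bool" where
  "psd A \<longleftrightarrow> transpose A = A \<and> (\<forall>v. 0 \<le> v \<bullet> (A *v v))"

text \<open>\<open>\<langle>A, B\<rangle> = trace (A B)\<close> for a real matrix \<open>A\<close> and a matrix \<open>B\<close> of polynomials.\<close>
definition trace_inner :: "real ^ 'k ^ 'k \<Rightarrow> 'n mpoly ^ 'k ^ 'k \<Rightarrow> 'n mpoly" where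
  "trace_inner A B = trace (map_matrix Const A ** B)"

definition mat2 :: "'a::zero \<Rightarrow> 'a \<Rightarrow> 'a \<Rightarrow> 'a \<Rightarrow> 'a ^ 2 ^ 2" where
  "mat2 a b c d = vector [vector [a, b], vector [c, d]]"

definition B1 :: "('n::finite) mpoly ^ 2 ^ 2" where
  "B1 = mat2 (p [4,4])   (p [4,2,2])
             (p [4,2,2]) (p [2,2,2,2])"

definition B2 :: "('n::finite) mpoly ^ 2 ^ 2" where
  "B2 = mat2 (p [4,2,2] - p [2,2,2,2]) (p [6,2] - p [4,2,2])
             (p [6,2] - p [4,2,2])     (p [8] - p [4,4])"

definition B3 :: "('n::finite) mpoly" where
  "B3 = (let n = real CARD('n) in
     Const ((- n + 1) / n^2) * p [8]
     + Const ((4 * n - 4) / n^2) * p [6,2]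
     + Const ((n^2 - 3 * n + 3) / n^2) * p [4,4]
     - 2 * p [4,2,2]
     + p [2,2,2,2])"

definition B4 :: "('n::finite) mpoly ^ 2 ^ 2" where
  "B4 = (let n = real CARD('n) in
     mat2 (p [2,2,2,2] - Const (1 / n) * p [4,2,2])
          (2 * p [4,2,2] - Const (2 / n) * p [6,2])
          (2 * p [4,2,2] - Const (2 / n) * p [6,2])
          (2 * p [6,2] + 2 * p [4,4] - Const (4 / n) * p [8]))"

definition B5 :: "('n::finite) mpoly" where
  "B5 = p [6,2] - p [4,4]"

definition B6 :: "('n::finite) mpoly" where
  "B6 = (let n = real CARD('n) in
     p [2,2,2,2]
     - Const (6 / n) * p [4,2,2]
     + Const (3 / n^2) * p [4,4]
     + Const (8 / n^2) * p [6,2]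
     - Const (6 / n^3) * p [8])"

definition B7 :: "('n::finite) mpoly" where
  "B7 = (let n = real CARD('n) in
     Const (2 / n^2) * p [8]
     - Const ((2 * n + 2) / n^2) * p [6,2]
     - Const (1 / n) * p [4,4]
     + Const ((n + 3) / n) * p [4,2,2]
     - p [2,2,2,2])"

end

theory Submission
  imports Defs
begin

text \<open>
  Let \<open>R\<close> be the average over signed permutations. An invariant sum of squares \<open>f = \<Sum> g\<^sup>2\<close> of
  quartics satisfies \<open>f = R f = \<Sum> R (g\<^sup>2)\<close>, and sign changes make the parts of \<open>g\<close> with different
  sets of odd exponents orthogonal for \<open>(g, h) \<mapsto> R (g h)\<close>. So \<open>g\<close> may be taken to be
  \<open>\<Sum> u\<^sub>i\<^sub>j x\<^sub>i\<^sup>2 x\<^sub>j\<^sup>2\<close>, \<open>x\<^sub>a x\<^sub>b \<Sum> v\<^sub>k x\<^sub>k\<^sup>2\<close> or \<open>c x\<^sub>a x\<^sub>b x\<^sub>c x\<^sub>d\<close>. The array \<open>R (x\<^sub>i\<^sup>2 x\<^sub>j\<^sup>2 x\<^sub>k\<^sup>2 x\<^sub>l\<^sup>2)\<close>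
  depends only on which indices coincide, hence is a combination of Kronecker deltas with five
  coefficients \<open>\<alpha>, \<beta>, \<gamma>, \<epsilon>, \<zeta>\<close>. In these terms \<open>B\<^sub>6\<close>, \<open>B\<^sub>7\<close> and \<open>B\<^sub>3\<close> are the same positive multiple of
  \<open>\<alpha>\<close>, \<open>\<beta>\<close> and \<open>\<gamma>\<close>, and splitting \<open>u\<close> into a constant part, a part given by row sums and diagonal,
  and a remainder with vanishing row sums (likewise for \<open>v\<close>) exhibits \<open>R (g\<^sup>2)\<close> as a combination of
  the \<open>B\<^sub>i\<close>. Conversely, every \<open>B\<^sub>i\<close> paired with a rank-one matrix is a sum of squares, mostly because
  it is a positive multiple of some \<open>R (g\<^sup>2)\<close>.
\<close>

section \<open>Polynomials and substitution\<close>

lemma lookup_Const_mult [simp]: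
  "Poly_Mapping.lookup (Const c * f) m = c * Poly_Mapping.lookup f m"
  unfolding Const_def mult_map_scale_conv_mult [symmetric]
  by (simp add: Poly_Mapping.map.rep_eq when_def)

lemma Const_0 [simp]: "Const 0 = 0"
  by (simp add: Const_def)

lemma Const_1 [simp]: "Const 1 = 1"
  by (simp add: Const_def)

lemma Const_add: "Const (a + b) = Const a + Const b"
  by (simp add: Const_def single_add)

lemma Const_mult: "Const (a * b) = Const a * Const b"
  by (simp add: Const_def mult_single)

lemma Const_uminus: "Const (- a) = - Const a"
  by (simp add: Const_def single_uminus)

lemma Const_numeral: "Const (numeral k) = numeral k"
  by (simp add: Const_def)

lemma Const_of_nat: "Const (of_nat k) = of_nat k"
  by (simp add: Const_def)

lemma Const_power: "Const (a ^ k) = Const a ^ k"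
  by (induction k) (simp_all add: Const_mult)

lemma Const_sum: "Const (sum h A) = (\<Sum>i\<in>A. Const (h i))"
  by (induction A rule: infinite_finite_induct) (simp_all add: Const_add)

lemma lookup_two_mult [simp]:
  "Poly_Mapping.lookup (2 * f) m = 2 * Poly_Mapping.lookup f m"
  for f :: "'n mpoly"
  using lookup_Const_mult [of 2 f m] by (simp only: Const_numeral)

lemma lookup_of_nat_mult [simp]:
  "Poly_Mapping.lookup (of_nat k * f) m = of_nat k * Poly_Mapping.lookup f m"
  for f :: "'n mpoly"
  using lookup_Const_mult [of "of_nat k" f m] by (simp only: Const_of_nat)

text \<open>The value of the monomial \<open>m\<close> under the substitution \<open>s\<close>; for
  \<open>s = X\<close> it is the monomial itself (\<open>monom_at_X\<close>).\<close>

definition monom_at :: "('n::finite \<Rightarrow> 'n mpoly) \<Rightarrow> ('n \<Rightarrow>\<^sub>0 nat) \<Rightarrow> 'n mpoly" where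
  "monom_at s m = (\<Prod>i\<in>UNIV. s i ^ Poly_Mapping.lookup m i)"

lemma monom_at_0 [simp]: "monom_at s 0 = 1"
  by (simp add: monom_at_def)

lemma monom_at_add: "monom_at s (m + m') = monom_at s m * monom_at s m'"
  by (simp add: monom_at_def lookup_add power_add prod.distrib)

lemma monom_at_single: "monom_at s (Poly_Mapping.single i k) = s i ^ k"
proof -
  have "monom_at s (Poly_Mapping.single i k) = (\<Prod>j\<in>UNIV. if j = i then s j ^ k else 1)"
    unfolding monom_at_def by (rule prod.cong) (auto simp: lookup_single when_def)
  then show ?thesis
    by simp
qed

text \<open>Exponents outside the support contribute zero. Polynomials with different supports can
  thus be expanded over one index set, which is what additivity needs.\<close>

lemma subst_eq_sum_superset:
  assumes "finite A" "Poly_Mapping.keys f \<subseteq> A"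
  shows "subst s f = (\<Sum>m\<in>A. Const (Poly_Mapping.lookup f m) * monom_at s m)"
  unfolding subst_def monom_at_def [symmetric]
  using assms by (intro sum.mono_neutral_left) (auto simp: in_keys_iff)

lemma subst_0 [simp]: "subst s 0 = 0"
  by (simp add: subst_def)

lemma subst_add: "subst s (f + g) = subst s f + subst s g"
proof -
  let ?A = "Poly_Mapping.keys f \<union> Poly_Mapping.keys g"
  have "subst s (f + g) = (\<Sum>m\<in>?A. Const (Poly_Mapping.lookup (f + g) m) * monom_at s m)"
    using keys_add [of f g] by (intro subst_eq_sum_superset) auto
  also have "\<dots> = (\<Sum>m\<in>?A. Const (Poly_Mapping.lookup f m) * monom_at s m)
      + (\<Sum>m\<in>?A. Const (Poly_Mapping.lookup g m) * monom_at s m)"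
    by (simp add: lookup_add Const_add distrib_right sum.distrib)
  also have "\<dots> = subst s f + subst s g"
    by (simp add: subst_eq_sum_superset [symmetric])
  finally show ?thesis .
qed

lemma subst_sum: "subst s (sum h A) = (\<Sum>a\<in>A. subst s (h a))"
  by (induction A rule: infinite_finite_induct) (simp_all add: subst_add)

lemma subst_single: "subst s (Poly_Mapping.single m c) = Const c * monom_at s m"
  by (subst subst_eq_sum_superset [where A = "{m}"]) auto

lemma subst_Const [simp]: "subst s (Const c) = Const c"
  by (simp add: Const_def [of c, THEN arg_cong [where f = "subst s"]] subst_single)

lemma subst_1 [simp]: "subst s 1 = 1"
  using subst_Const [of s 1] by simp

lemma subst_X [simp]: "subst s (X i) = s i"
  by (simp add: X_def subst_single monom_at_single)

lemma sum_single_keys: "(\<Sum>m\<in>Poly_Mapping.keys f. Poly_Mapping.single m (Poly_Mapping.lookup f m)) = f"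
  by (rule poly_mapping_eqI) (auto simp: lookup_sum lookup_single when_def in_keys_iff)

text \<open>Both factors are expanded into single terms, where multiplicativity reduces to the
  addition of exponents (\<open>monom_at_add\<close>).\<close>

lemma subst_mult: "subst s (f * g) = subst s f * subst s g"
proof -
  let ?t = "\<lambda>h m. Poly_Mapping.single m (Poly_Mapping.lookup h m)"
  have single: "subst s (?t f m * ?t g m') = subst s (?t f m) * subst s (?t g m')" for m m'
    by (simp add: mult_single subst_single monom_at_add Const_mult mult_ac)
  have "subst s (f * g)
      = subst s ((\<Sum>m\<in>Poly_Mapping.keys f. ?t f m) * (\<Sum>m\<in>Poly_Mapping.keys g. ?t g m))"
    by (simp only: sum_single_keys)
  also have "\<dots> = (\<Sum>m\<in>Poly_Mapping.keys f. \<Sum>m'\<in>Poly_Mapping.keys g.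
      subst s (?t f m) * subst s (?t g m'))"
    by (simp add: sum_product subst_sum single)
  also have "\<dots> = subst s (\<Sum>m\<in>Poly_Mapping.keys f. ?t f m) *
      subst s (\<Sum>m\<in>Poly_Mapping.keys g. ?t g m)"
    by (simp add: sum_product subst_sum)
  finally show ?thesis
    by (simp only: sum_single_keys)
qed

lemma subst_power: "subst s (f ^ k) = subst s f ^ k"
  by (induction k) (simp_all add: subst_mult)

lemma subst_prod: "subst s (prod h A) = (\<Prod>a\<in>A. subst s (h a))"
  by (induction A rule: infinite_finite_induct) (simp_all add: subst_mult)

lemma subst_uminus: "subst s (- f) = - subst s f"
  by (metis subst_add subst_0 add.right_inverse minus_unique)

lemma subst_diff: "subst s (f - g) = subst s f - subst s g"
  using subst_add [of s f "- g"] by (simp add: subst_uminus)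

lemma subst_subst: "subst t (subst s f) = subst (\<lambda>i. subst t (s i)) f"
  by (simp add: subst_def [of s] subst_def [of "\<lambda>i. subst t (s i)"]
      subst_sum subst_mult subst_prod subst_power)

lemma monom_at_X:
  fixes m :: "('n::finite) \<Rightarrow>\<^sub>0 nat"
  shows "monom_at X m = Poly_Mapping.single m 1"
proof -
  have X_power: "X i ^ k = Poly_Mapping.single (Poly_Mapping.single i k) 1" for i :: 'n and k
  proof (induction k)
    case (Suc k)
    then show ?case
      by (simp add: X_def mult_single single_add [symmetric])
  qed simp
  have "(\<Prod>i\<in>A. X i ^ Poly_Mapping.lookup m i)
      = Poly_Mapping.single (\<Sum>i\<in>A. Poly_Mapping.single i (Poly_Mapping.lookup m i)) 1"
    for A :: "'n set"
    by (induction A rule: infinite_finite_induct) (simp_all add: X_power mult_single)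
  moreover have "(\<Sum>i\<in>UNIV. Poly_Mapping.single i (Poly_Mapping.lookup m i)) = m"
    by (rule poly_mapping_eqI) (simp add: lookup_sum lookup_single when_def)
  ultimately show ?thesis
    by (simp add: monom_at_def)
qed

lemma mpoly_eq_sum_monoms:
  "f = (\<Sum>m\<in>Poly_Mapping.keys f. Const (Poly_Mapping.lookup f m) * monom_at X m)"
proof -
  have "Const c * monom_at X m = Poly_Mapping.single m c" for c and m :: "'a \<Rightarrow>\<^sub>0 nat"
    by (simp add: monom_at_X Const_def mult_single)
  then show ?thesis
    by (simp add: sum_single_keys)
qed

section \<open>Homogeneity\<close>

definition mdeg :: "('n::finite \<Rightarrow>\<^sub>0 nat) \<Rightarrow> nat" where
  "mdeg m = (\<Sum>i\<in>UNIV. Poly_Mapping.lookup m i)"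

lemma mdeg_add: "mdeg (m + m') = mdeg m + mdeg m'"
  by (simp add: mdeg_def lookup_add sum.distrib)

lemma mdeg_single: "mdeg (Poly_Mapping.single i k) = k"
  by (simp add: mdeg_def lookup_single when_def)

lemma homogeneous_iff: "homogeneous d f \<longleftrightarrow> (\<forall>m\<in>Poly_Mapping.keys f. mdeg m = d)"
  by (simp add: homogeneous_def mdeg_def)

lemma homogeneous_lookup: "homogeneous d f \<Longrightarrow> mdeg m \<noteq> d \<Longrightarrow> Poly_Mapping.lookup f m = 0"
  by (auto simp: homogeneous_iff in_keys_iff)

lemma homogeneous_0 [simp]: "homogeneous d 0"
  by (simp add: homogeneous_iff)

lemma homogeneous_Const [simp]: "homogeneous 0 (Const c)"
  by (auto simp: homogeneous_iff Const_def mdeg_def)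

lemma homogeneous_X [simp]: "homogeneous 1 (X i)"
  by (simp add: homogeneous_iff X_def mdeg_single)

lemma homogeneous_add: "homogeneous d f \<Longrightarrow> homogeneous d g \<Longrightarrow> homogeneous d (f + g)"
  using keys_add [of f g] by (auto simp: homogeneous_iff)

lemma homogeneous_uminus: "homogeneous d f \<Longrightarrow> homogeneous d (- f)"
  by (auto simp: homogeneous_iff in_keys_iff)

lemma homogeneous_diff: "homogeneous d f \<Longrightarrow> homogeneous d g \<Longrightarrow> homogeneous d (f - g)"
  using homogeneous_add [of d f "- g"] homogeneous_uminus [of d g] by simp

lemma homogeneous_sum: "(\<And>a. a \<in> A \<Longrightarrow> homogeneous d (h a)) \<Longrightarrow> homogeneous d (sum h A)"
  by (induction A rule: infinite_finite_induct) (auto intro: homogeneous_add)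

lemma homogeneous_mult:
  assumes "homogeneous d f" "homogeneous e g"
  shows "homogeneous (d + e) (f * g)"
  using assms keys_mult [of f g] by (fastforce simp: homogeneous_iff mdeg_add)

lemma homogeneous_mult_eq:
  "homogeneous d f \<Longrightarrow> homogeneous e g \<Longrightarrow> c = d + e \<Longrightarrow> homogeneous c (f * g)"
  using homogeneous_mult by blast

lemma homogeneous_Const_mult: "homogeneous d f \<Longrightarrow> homogeneous d (Const c * f)"
  by (rule homogeneous_mult_eq [OF homogeneous_Const]) simp_all

lemma homogeneous_power: "homogeneous d f \<Longrightarrow> homogeneous (k * d) (f ^ k)"
  by (induction k) (use homogeneous_Const [of 1] in \<open>auto intro: homogeneous_mult\<close>)

lemma homogeneous_prod:
  "finite A \<Longrightarrow> (\<And>a. a \<in> A \<Longrightarrow> homogeneous (e a) (h a)) \<Longrightarrow> homogeneous (sum e A) (prod h A)"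
  by (induction A rule: finite_induct) (use homogeneous_Const [of 1] in \<open>auto intro: homogeneous_mult\<close>)

lemma homogeneous_subst:
  assumes "\<And>i. homogeneous 1 (s i)" "homogeneous d f"
  shows "homogeneous d (subst s f)"
  unfolding subst_def
proof (intro homogeneous_sum homogeneous_Const_mult)
  fix m assume "m \<in> Poly_Mapping.keys f"
  then have "mdeg m = d"
    using assms(2) by (simp add: homogeneous_iff)
  moreover have "homogeneous (\<Sum>i\<in>UNIV. Poly_Mapping.lookup m i * 1)
      (\<Prod>i\<in>UNIV. s i ^ Poly_Mapping.lookup m i)"
    by (intro homogeneous_prod homogeneous_power assms) simp
  ultimately show "homogeneous d (\<Prod>i\<in>UNIV. s i ^ Poly_Mapping.lookup m i)"
    by (simp add: mdeg_def)
qed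

section \<open>Averaging over signed permutations\<close>

definition act :: "('n::finite \<Rightarrow> 'n) \<times> ('n \<Rightarrow> real) \<Rightarrow> 'n mpoly \<Rightarrow> 'n mpoly" where
  "act t = subst (\<lambda>i. Const (snd t i) * X (fst t i))"

text \<open>The Reynolds operator of the hyperoctahedral group. Group elements are plain pairs;
  their closure under composition is established inside \<open>reynolds_act\<close>.\<close>

definition reynolds :: "('n::finite) mpoly \<Rightarrow> 'n mpoly" where
  "reynolds f = Const (1 / real (card (signed_perms :: (('n \<Rightarrow> 'n) \<times> ('n \<Rightarrow> real)) set))) *
     (\<Sum>t\<in>signed_perms. act t f)"

lemma finite_signed_perms: "finite (signed_perms :: (('n::finite \<Rightarrow> 'n) \<times> ('n \<Rightarrow> real)) set)"
proof (rule finite_subset)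
  show "signed_perms \<subseteq> (UNIV :: ('n \<Rightarrow> 'n) set) \<times> (UNIV \<rightarrow>\<^sub>E {1, -1})"
    by (auto simp: signed_perms_def)
  show "finite ((UNIV :: ('n \<Rightarrow> 'n) set) \<times> ((UNIV :: 'n set) \<rightarrow>\<^sub>E {1, -1 :: real}))"
    by (intro finite_SigmaI finite_PiE) auto
qed

lemma card_signed_perms: "card (signed_perms :: (('n::finite \<Rightarrow> 'n) \<times> ('n \<Rightarrow> real)) set) \<noteq> 0"
proof -
  have "(id, \<lambda>_. 1) \<in> (signed_perms :: (('n \<Rightarrow> 'n) \<times> ('n \<Rightarrow> real)) set)"
    by (simp add: signed_perms_def)
  then show ?thesis
    using finite_signed_perms card_0_eq by fastforce
qed

lemma act_simps:
  "act t (f + g) = act t f + act t g"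
  "act t (f - g) = act t f - act t g"
  "act t (- f) = - act t f"
  "act t (f * g) = act t f * act t g"
  "act t (f ^ k) = act t f ^ k"
  "act t (Const c) = Const c"
  "act t (sum h A) = (\<Sum>a\<in>A. act t (h a))"
  "act t (prod h A) = (\<Prod>a\<in>A. act t (h a))"
  "act t (X i) = Const (snd t i) * X (fst t i)"
  by (simp_all add: act_def subst_add subst_diff subst_uminus subst_mult subst_power subst_sum subst_prod)

lemma homogeneous_act: "homogeneous d f \<Longrightarrow> homogeneous d (act t f)"
  unfolding act_def by (intro homogeneous_subst homogeneous_Const_mult homogeneous_X)

lemma reynolds_0 [simp]: "reynolds 0 = 0"
  by (simp add: reynolds_def act_def)

lemma reynolds_add: "reynolds (f + g) = reynolds f + reynolds g"
  by (simp add: reynolds_def act_simps sum.distrib distrib_left)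

lemma reynolds_uminus: "reynolds (- f) = - reynolds f"
  by (simp add: reynolds_def act_simps sum_negf)

lemma reynolds_diff: "reynolds (f - g) = reynolds f - reynolds g"
  using reynolds_add [of f "- g"] by (simp add: reynolds_uminus)

lemma reynolds_sum: "reynolds (sum h A) = (\<Sum>a\<in>A. reynolds (h a))"
  by (induction A rule: infinite_finite_induct) (simp_all add: reynolds_add)

lemma reynolds_Const_mult: "reynolds (Const c * f) = Const c * reynolds f"
  by (simp add: reynolds_def act_simps sum_distrib_left mult_ac)

lemma reynolds_fixed:
  fixes f :: "('n::finite) mpoly"
  assumes "\<And>t. t \<in> signed_perms \<Longrightarrow> act t f = f"
  shows "reynolds f = f"
  by (rule poly_mapping_eqI)
    (use card_signed_perms [where 'n = 'n] in \<open>simp add: reynolds_def lookup_sum assms\<close>)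

lemma reynolds_even_symmetric:
  assumes "f \<in> even_symmetric_forms d"
  shows "reynolds f = f"
  using assms by (intro reynolds_fixed) (auto simp: even_symmetric_forms_def act_def)

text \<open>Precomposition with \<open>t\<close> permutes the signed permutations and so only
  reorders the sum. As the set is finite, it is enough that this map is injective and stays inside
  the set.\<close>

lemma reynolds_act:
  fixes f :: "('n::finite) mpoly"
  assumes "t \<in> signed_perms"
  shows "reynolds (act t f) = reynolds f"
proof -
  \<comment> \<open>\<open>r u\<close> is the pair acting as \<open>act u\<close> after
    \<open>act t\<close>: the variable with index \<open>i\<close> is first sent to index
    \<open>fst t i\<close>, so the sign of \<open>u\<close> is read there.\<close>
  define r :: "(('n \<Rightarrow> 'n) \<times> ('n \<Rightarrow> real)) \<Rightarrow> (('n \<Rightarrow> 'n) \<times> ('n \<Rightarrow> real))"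
    where "r u = (fst u \<circ> fst t, \<lambda>i. snd t i * snd u (fst t i))" for u
  have bij: "bij (fst t)" and sgn: "snd t i \<in> {1, -1}" for i
    using assms by (auto simp: signed_perms_def)
  have comp: "act u (act t f) = act (r u) f" for u
    by (simp add: act_def subst_subst subst_mult r_def Const_mult mult_ac)
  have "inj r"
  proof (rule injI)
    fix u v assume eq: "r u = r v"
    have *: "fst u (fst t i) = fst v (fst t i)" for i
      using arg_cong [OF eq, of "\<lambda>w. fst w i"] by (simp add: r_def)
    have "fst u j = fst v j" for j
      using * [of "inv (fst t) j"] bij by (simp add: bij_is_surj surj_f_inv_f)
    then have "fst u = fst v"
      by blast
    have **: "snd u (fst t i) = snd v (fst t i)" for i
      using arg_cong [OF eq, of "\<lambda>w. snd w i"] sgn [of i] by (auto simp: r_def)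
    have "snd u j = snd v j" for j
      using ** [of "inv (fst t) j"] bij by (simp add: bij_is_surj surj_f_inv_f)
    then have "snd u = snd v"
      by blast
    with \<open>fst u = fst v\<close> show "u = v"
      by (simp add: prod_eq_iff)
  qed
  moreover have "r u \<in> signed_perms" if "u \<in> signed_perms" for u
  proof -
    have u: "bij (fst u)" "snd u (fst t i) \<in> {1, -1}" for i
      using that by (auto simp: signed_perms_def)
    have "snd t i * snd u (fst t i) \<in> {1, -1}" for i
      using sgn [of i] u(2) [of i] by auto
    then show ?thesis
      using bij u(1) by (auto simp: signed_perms_def r_def bij_comp)
  qed
  then have sub: "r ` signed_perms \<subseteq> signed_perms"
    by blast
  ultimately have "bij_betw r signed_perms signed_perms"
    unfolding bij_betw_def
    using endo_inj_surj [OF finite_signed_perms sub] inj_on_subset by blast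
  then have "(\<Sum>u\<in>signed_perms. act (r u) f) = (\<Sum>u\<in>signed_perms. act u f)"
    by (rule sum.reindex_bij_betw)
  then show ?thesis
    by (simp add: reynolds_def comp)
qed

text \<open>By invariance the average equals its own negative. This is how sign changes make parity
  parts orthogonal.\<close>

lemma reynolds_eq_0:
  assumes "t \<in> signed_perms" "act t f = - f"
  shows "reynolds f = 0"
proof -
  have "reynolds f = - reynolds f"
    using reynolds_act [OF assms(1), of f] assms(2) by (simp add: reynolds_uminus)
  then have "Poly_Mapping.lookup (reynolds f) m = - Poly_Mapping.lookup (reynolds f) m" for m
    by (metis lookup_uminus)
  then show ?thesis
    by (intro poly_mapping_eqI) simp
qed

section \<open>Totally symmetric quadruple arrays\<close>

text \<open>Permutations act transitively on tuples of distinct elements. It transports values of an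
  invariant array between index tuples with the same coincidences.\<close>

lemma exists_bij_map:
  fixes xs ys :: "'a list"
  assumes "distinct xs" "distinct ys" "length xs = length ys"
  shows "\<exists>\<tau>. bij \<tau> \<and> map \<tau> xs = ys"
  using assms(3,1,2)
proof (induction xs ys rule: list_induct2)
  case Nil
  show ?case
    by (rule exI [of _ "\<lambda>x. x"]) (simp add: bij_id [unfolded id_def])
next
  case (Cons x xs y ys)
  from Cons.prems have "distinct xs" "distinct ys"
    by simp_all
  from Cons.IH [OF this] obtain \<tau> where \<tau>: "bij \<tau>" "map \<tau> xs = ys"
    by blast
  \<comment> \<open>The transposition corrects the image of \<open>x\<close> and moves nothing else
    than \<open>\<tau> x\<close> and \<open>y\<close>, neither of which lies among the images
    already fixed.\<close>
  let ?\<sigma> = "Transposition.transpose (\<tau> x) y \<circ> \<tau>"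
  have "?\<sigma> z = \<tau> z" if "z \<in> set xs" for z
  proof -
    have "z \<noteq> x"
      using that Cons.prems(1) by auto
    then have "\<tau> z \<noteq> \<tau> x"
      using \<tau>(1) by (simp add: bij_is_inj inj_eq)
    moreover have "\<tau> z \<in> set ys"
      unfolding \<tau>(2) [symmetric] using that by simp
    then have "\<tau> z \<noteq> y"
      using Cons.prems(2) by auto
    ultimately show ?thesis
      by (simp add: transpose_apply_other)
  qed
  then have "map ?\<sigma> xs = map \<tau> xs"
    by (rule map_cong [OF refl])
  then have "map ?\<sigma> (x # xs) = y # ys"
    by (simp add: \<tau>(2))
  moreover have "bij ?\<sigma>"
    using \<tau>(1) bij_transpose by (rule bij_comp)
  ultimately show ?case
    by (intro exI conjI)
qed

text \<open>One sum of Kronecker deltas for each partition of 4: the types 1+1+1+1, 2+1+1, 2+2, 3+1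
  and 4 carry \<alpha>, \<beta>, \<gamma>, \<epsilon> and \<zeta>. The contributions accumulate: at
  four equal indices all of them are counted.\<close>

definition pattern :: "real \<Rightarrow> real \<Rightarrow> real \<Rightarrow> real \<Rightarrow> real \<Rightarrow> 'n \<Rightarrow> 'n \<Rightarrow> 'n \<Rightarrow> 'n \<Rightarrow> real" where
  "pattern \<alpha> \<beta> \<gamma> \<epsilon> \<zeta> i j k l = \<alpha>
     + \<beta> * (of_bool (i = j) + of_bool (i = k) + of_bool (i = l)
         + of_bool (j = k) + of_bool (j = l) + of_bool (k = l))
     + \<gamma> * (of_bool (i = j \<and> k = l) + of_bool (i = k \<and> j = l) + of_bool (i = l \<and> j = k))
     + \<epsilon> * (of_bool (i = j \<and> i = k) + of_bool (i = j \<and> i = l)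
         + of_bool (i = k \<and> i = l) + of_bool (j = k \<and> j = l))
     + \<zeta> * of_bool (i = j \<and> i = k \<and> i = l)"

text \<open>An invariant symmetric array has only five values, one for each coincidence type, and
  the five delta sums separate these types. The first coefficient is given explicitly so that it can
  be identified with the value at four distinct indices.\<close>

lemma symmetric_invariant_imp_pattern:
  fixes E :: "'n::finite \<Rightarrow> 'n \<Rightarrow> 'n \<Rightarrow> 'n \<Rightarrow> real"
  assumes dist: "distinct [a, b, c, d]"
    and sym: "\<And>i j k l. E i j k l = E j i k l" "\<And>i j k l. E i j k l = E i k j l"
      "\<And>i j k l. E i j k l = E i j l k"
    and inv: "\<And>\<tau> i j k l. bij \<tau> \<Longrightarrow> E (\<tau> i) (\<tau> j) (\<tau> k) (\<tau> l) = E i j k l"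
  shows "\<exists>\<epsilon> \<zeta>. E = pattern (E a b c d) (E a a b c - E a b c d)
           (E a a b b - 2 * E a a b c + E a b c d) \<epsilon> \<zeta>"
proof -
  \<comment> \<open>The subscripts record the multiplicities of the indices.\<close>
  define V4 V31 V22 V211 V1111 where V: "V4 = E a a a a" "V31 = E a a a b" "V22 = E a a b b"
    "V211 = E a a b c" "V1111 = E a b c d"
  have tuple: "E i j k l = V1111" if ijkl: "distinct [i, j, k, l]" for i j k l
  proof -
    obtain \<tau> where "bij \<tau>" "map \<tau> [a, b, c, d] = [i, j, k, l]"
      using exists_bij_map [OF dist ijkl] by auto
    then show ?thesis
      using inv [of \<tau> a b c d] by (simp add: V)
  qed
  have triple: "E i i k l = V211" if ikl: "distinct [i, k, l]" for i k l
  proof -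
    obtain \<tau> where "bij \<tau>" "map \<tau> [a, b, c] = [i, k, l]"
      using exists_bij_map [OF _ ikl, of "[a, b, c]"] dist by auto
    then show ?thesis
      using inv [of \<tau> a a b c] by (simp add: V)
  qed
  have pair: "E i i k k = V22" "E i i i k = V31" if ik: "i \<noteq> k" for i k
  proof -
    obtain \<tau> where "bij \<tau>" "map \<tau> [a, b] = [i, k]"
      using exists_bij_map [of "[a, b]" "[i, k]"] dist ik by auto
    then show "E i i k k = V22" "E i i i k = V31"
      using inv [of \<tau> a a b b] inv [of \<tau> a a a b] by (simp_all add: V)
  qed
  have one: "E i i i i = V4" for i
  proof -
    obtain \<tau> where "bij \<tau>" "map \<tau> [a] = [i]"
      using exists_bij_map [of "[a]" "[i]"] by auto
    then show ?thesis
      using inv [of \<tau> a a a a] by (simp add: V)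
  qed
  have pair_perms: "E i k i k = V22" "E i k k i = V22"
      "E i i k i = V31" "E i k i i = V31" "E k i i i = V31" if "i \<noteq> k" for i k
    by (simp_all only: pair [OF that] sym(2) [of i k i k] sym(3) [of i k k i]
        sym(3) [of i i k i] sym(2) [of i k i i] sym(1) [of k i i i])
  have triple_perms: "E i k i l = V211" "E i k l i = V211" "E k i i l = V211"
      "E k i l i = V211" "E k l i i = V211" if "distinct [i, k, l]" for i k l
    by (simp_all only: triple [OF that] sym(2) [of i k i l] sym(3) [of i k l i]
        sym(1) [of k i i l] sym(3) [of k i l i] sym(2) [of k l i i])
  \<comment> \<open>The coefficients solve the triangular system V1111 = \<alpha>, V211 = \<alpha> +
    \<beta>, V22 = \<alpha> + 2\<beta> + \<gamma>, V31 = \<alpha> + 3\<beta> + \<epsilon>, V4 =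
    \<alpha> + 6\<beta> + 3\<gamma> + 4\<epsilon> + \<zeta>.\<close>
  have "E = pattern V1111 (V211 - V1111) (V22 - 2 * V211 + V1111) (V31 - 3 * V211 + 2 * V1111)
      (V4 - 4 * V31 - 3 * V22 + 12 * V211 - 6 * V1111)"
  proof (intro ext)
    fix i j k l
    show "E i j k l = pattern V1111 (V211 - V1111) (V22 - 2 * V211 + V1111)
      (V31 - 3 * V211 + 2 * V1111) (V4 - 4 * V31 - 3 * V22 + 12 * V211 - 6 * V1111) i j k l"
      using tuple [of i j k l]
      by (cases "i = j"; cases "i = k"; cases "i = l"; cases "j = k"; cases "j = l"; cases "k = l")
        (simp_all add: pattern_def one pair pair_perms triple triple_perms)
  qed
  then show ?thesis
    unfolding V by blast
qed

text \<open>Every delta removes one summation per identified index. \<open>F\<close> need not be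
  symmetric, so each way of identifying indices keeps its own sum.\<close>

lemma sum_mult_pattern:
  fixes F :: "'n::finite \<Rightarrow> 'n \<Rightarrow> 'n \<Rightarrow> 'n \<Rightarrow> real"
  shows "(\<Sum>i\<in>UNIV. \<Sum>j\<in>UNIV. \<Sum>k\<in>UNIV. \<Sum>l\<in>UNIV. F i j k l * pattern \<alpha> \<beta> \<gamma> \<epsilon> \<zeta> i j k l) =
    \<alpha> * (\<Sum>i\<in>UNIV. \<Sum>j\<in>UNIV. \<Sum>k\<in>UNIV. \<Sum>l\<in>UNIV. F i j k l)
    + \<beta> * ((\<Sum>i\<in>UNIV. \<Sum>k\<in>UNIV. \<Sum>l\<in>UNIV. F i i k l) + (\<Sum>i\<in>UNIV. \<Sum>j\<in>UNIV. \<Sum>l\<in>UNIV. F i j i l)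
      + (\<Sum>i\<in>UNIV. \<Sum>j\<in>UNIV. \<Sum>k\<in>UNIV. F i j k i) + (\<Sum>i\<in>UNIV. \<Sum>j\<in>UNIV. \<Sum>l\<in>UNIV. F i j j l)
      + (\<Sum>i\<in>UNIV. \<Sum>j\<in>UNIV. \<Sum>k\<in>UNIV. F i j k j) + (\<Sum>i\<in>UNIV. \<Sum>j\<in>UNIV. \<Sum>k\<in>UNIV. F i j k k))
    + \<gamma> * ((\<Sum>i\<in>UNIV. \<Sum>k\<in>UNIV. F i i k k) + (\<Sum>i\<in>UNIV. \<Sum>j\<in>UNIV. F i j i j)
      + (\<Sum>i\<in>UNIV. \<Sum>j\<in>UNIV. F i j j i))
    + \<epsilon> * ((\<Sum>i\<in>UNIV. \<Sum>l\<in>UNIV. F i i i l) + (\<Sum>i\<in>UNIV. \<Sum>k\<in>UNIV. F i i k i)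
      + (\<Sum>i\<in>UNIV. \<Sum>j\<in>UNIV. F i j i i) + (\<Sum>i\<in>UNIV. \<Sum>j\<in>UNIV. F i j j j))
    + \<zeta> * (\<Sum>i\<in>UNIV. F i i i i)"
proof -
  let ?S = "\<lambda>G. \<Sum>i\<in>UNIV. \<Sum>j\<in>UNIV. \<Sum>k\<in>UNIV. \<Sum>l\<in>UNIV. F i j k l * of_bool (G i j k l)"
  have delta: "(\<Sum>j\<in>UNIV. h j * of_bool (i = j)) = h i" for h :: "'n \<Rightarrow> real" and i
    by (simp add: of_bool_def if_distrib cong: if_cong)
  have pairs: "?S (\<lambda>i j k l. i = j) = (\<Sum>i\<in>UNIV. \<Sum>k\<in>UNIV. \<Sum>l\<in>UNIV. F i i k l)"
    "?S (\<lambda>i j k l. i = k) = (\<Sum>i\<in>UNIV. \<Sum>j\<in>UNIV. \<Sum>l\<in>UNIV. F i j i l)"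
    "?S (\<lambda>i j k l. i = l) = (\<Sum>i\<in>UNIV. \<Sum>j\<in>UNIV. \<Sum>k\<in>UNIV. F i j k i)"
    "?S (\<lambda>i j k l. j = k) = (\<Sum>i\<in>UNIV. \<Sum>j\<in>UNIV. \<Sum>l\<in>UNIV. F i j j l)"
    "?S (\<lambda>i j k l. j = l) = (\<Sum>i\<in>UNIV. \<Sum>j\<in>UNIV. \<Sum>k\<in>UNIV. F i j k j)"
    "?S (\<lambda>i j k l. k = l) = (\<Sum>i\<in>UNIV. \<Sum>j\<in>UNIV. \<Sum>k\<in>UNIV. F i j k k)"
    by ((simp only: sum_distrib_right [symmetric] delta)+)
  have more: "?S (\<lambda>i j k l. i = j \<and> k = l) = (\<Sum>i\<in>UNIV. \<Sum>k\<in>UNIV. F i i k k)"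
    "?S (\<lambda>i j k l. i = k \<and> j = l) = (\<Sum>i\<in>UNIV. \<Sum>j\<in>UNIV. F i j i j)"
    "?S (\<lambda>i j k l. i = l \<and> j = k) = (\<Sum>i\<in>UNIV. \<Sum>j\<in>UNIV. F i j j i)"
    "?S (\<lambda>i j k l. i = j \<and> i = k) = (\<Sum>i\<in>UNIV. \<Sum>l\<in>UNIV. F i i i l)"
    "?S (\<lambda>i j k l. i = j \<and> i = l) = (\<Sum>i\<in>UNIV. \<Sum>k\<in>UNIV. F i i k i)"
    "?S (\<lambda>i j k l. i = k \<and> i = l) = (\<Sum>i\<in>UNIV. \<Sum>j\<in>UNIV. F i j i i)"
    "?S (\<lambda>i j k l. j = k \<and> j = l) = (\<Sum>i\<in>UNIV. \<Sum>j\<in>UNIV. F i j j j)"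
    "?S (\<lambda>i j k l. i = j \<and> i = k \<and> i = l) = (\<Sum>i\<in>UNIV. F i i i i)"
    by ((simp only: of_bool_conj mult.assoc [symmetric] sum_distrib_right [symmetric] delta)+)
  have "F i j k l * pattern \<alpha> \<beta> \<gamma> \<epsilon> \<zeta> i j k l = \<alpha> * F i j k l
     + \<beta> * (F i j k l * of_bool (i = j) + F i j k l * of_bool (i = k) + F i j k l * of_bool (i = l)
         + F i j k l * of_bool (j = k) + F i j k l * of_bool (j = l) + F i j k l * of_bool (k = l))
     + \<gamma> * (F i j k l * of_bool (i = j \<and> k = l) + F i j k l * of_bool (i = k \<and> j = l)
         + F i j k l * of_bool (i = l \<and> j = k))
     + \<epsilon> * (F i j k l * of_bool (i = j \<and> i = k) + F i j k l * of_bool (i = j \<and> i = l)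
         + F i j k l * of_bool (i = k \<and> i = l) + F i j k l * of_bool (j = k \<and> j = l))
     + \<zeta> * (F i j k l * of_bool (i = j \<and> i = k \<and> i = l))" for i j k l
    unfolding pattern_def by (simp only: ring_distribs mult_ac add_ac)
  then show ?thesis
    unfolding pairs [symmetric] more [symmetric]
    by (simp only: sum.distrib sum_distrib_left [symmetric])
qed

section \<open>Sums and power-mean averages of pattern arrays\<close>

lemma pattern_total:
  fixes \<alpha> \<beta> \<gamma> \<epsilon> \<zeta> :: real
  defines "S \<equiv> pattern \<alpha> \<beta> \<gamma> \<epsilon> \<zeta> :: 'n::finite \<Rightarrow> 'n \<Rightarrow> 'n \<Rightarrow> 'n \<Rightarrow> real"
    and "N \<equiv> real CARD('n)"
  shows "(\<Sum>i\<in>UNIV. S i i i i) = N * (\<alpha> + 6 * \<beta> + 3 * \<gamma> + 4 * \<epsilon> + \<zeta>)"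
    "(\<Sum>i\<in>UNIV. \<Sum>j\<in>UNIV. S i i i j)
      = N^2 * (\<alpha> + 3 * \<beta> + \<epsilon>) + N * (3 * \<beta> + 3 * \<gamma> + 3 * \<epsilon> + \<zeta>)"
    "(\<Sum>i\<in>UNIV. \<Sum>j\<in>UNIV. S i i j j)
      = N^2 * (\<alpha> + 2 * \<beta> + \<gamma>) + N * (4 * \<beta> + 2 * \<gamma> + 4 * \<epsilon> + \<zeta>)"
    "(\<Sum>i\<in>UNIV. \<Sum>j\<in>UNIV. \<Sum>k\<in>UNIV. S i i j k)
      = N^3 * (\<alpha> + \<beta>) + N^2 * (5 * \<beta> + \<gamma> + 2 * \<epsilon>) + N * (2 * \<gamma> + 2 * \<epsilon> + \<zeta>)"
    "(\<Sum>i\<in>UNIV. \<Sum>j\<in>UNIV. \<Sum>k\<in>UNIV. \<Sum>l\<in>UNIV. S i j k l)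
      = N^4 * \<alpha> + 6 * N^3 * \<beta> + N^2 * (3 * \<gamma> + 4 * \<epsilon>) + N * \<zeta>"
proof -
  have delta: "(\<Sum>j\<in>UNIV. of_bool (i = j)) = (1 :: real)" for i :: 'n
    by (simp add: of_bool_def)
  show "(\<Sum>i\<in>UNIV. S i i i i) = N * (\<alpha> + 6 * \<beta> + 3 * \<gamma> + 4 * \<epsilon> + \<zeta>)"
    by (simp add: S_def N_def pattern_def algebra_simps)
  show "(\<Sum>i\<in>UNIV. \<Sum>j\<in>UNIV. S i i i j)
      = N^2 * (\<alpha> + 3 * \<beta> + \<epsilon>) + N * (3 * \<beta> + 3 * \<gamma> + 3 * \<epsilon> + \<zeta>)"
  proof -
    have "S i i i j = (\<alpha> + 3 * \<beta> + \<epsilon>) + (3 * \<beta> + 3 * \<gamma> + 3 * \<epsilon> + \<zeta>) * of_bool (i = j)" for i j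
      by (simp add: S_def pattern_def algebra_simps)
    then show ?thesis
      by (simp add: sum.distrib delta sum_distrib_left [symmetric] N_def power2_eq_square algebra_simps del: sum_of_bool_eq)
  qed
  show "(\<Sum>i\<in>UNIV. \<Sum>j\<in>UNIV. S i i j j)
      = N^2 * (\<alpha> + 2 * \<beta> + \<gamma>) + N * (4 * \<beta> + 2 * \<gamma> + 4 * \<epsilon> + \<zeta>)"
  proof -
    have "S i i j j = (\<alpha> + 2 * \<beta> + \<gamma>) + (4 * \<beta> + 2 * \<gamma> + 4 * \<epsilon> + \<zeta>) * of_bool (i = j)" for i j
      by (simp add: S_def pattern_def algebra_simps)
    then show ?thesis
      by (simp add: sum.distrib delta sum_distrib_left [symmetric] N_def power2_eq_square algebra_simps del: sum_of_bool_eq)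
  qed
  show "(\<Sum>i\<in>UNIV. \<Sum>j\<in>UNIV. \<Sum>k\<in>UNIV. S i i j k)
      = N^3 * (\<alpha> + \<beta>) + N^2 * (5 * \<beta> + \<gamma> + 2 * \<epsilon>) + N * (2 * \<gamma> + 2 * \<epsilon> + \<zeta>)"
  proof -
    have "S i i j k = (\<alpha> + \<beta>) + (2 * \<beta> + \<epsilon>) * of_bool (i = j) + (2 * \<beta> + \<epsilon>) * of_bool (i = k)
        + (\<beta> + \<gamma>) * of_bool (j = k)
        + (2 * \<gamma> + 2 * \<epsilon> + \<zeta>) * (of_bool (i = j) * of_bool (i = k))" for i j k
      by (simp add: S_def pattern_def of_bool_def algebra_simps)
    then show ?thesis
      by (simp add: sum.distrib delta sum_distrib_left [symmetric] N_def power2_eq_square power3_eq_cube algebra_simps del: sum_of_bool_eq)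
  qed
  show "(\<Sum>i\<in>UNIV. \<Sum>j\<in>UNIV. \<Sum>k\<in>UNIV. \<Sum>l\<in>UNIV. S i j k l)
      = N^4 * \<alpha> + 6 * N^3 * \<beta> + N^2 * (3 * \<gamma> + 4 * \<epsilon>) + N * \<zeta>"
    using sum_mult_pattern [of "\<lambda>(i :: 'n) j k l. 1" \<alpha> \<beta> \<gamma> \<epsilon> \<zeta>]
    by (simp add: S_def N_def eval_nat_numeral algebra_simps)
qed

text \<open>The digits in the names are the parts of a partition of 8; a part 2k becomes k equal
  indices. On the array \<open>quad_coeff m\<close> these means are the coefficients of
  \<open>m\<close> in the corresponding \<open>p\<close> (\<open>lookup_p\<close>).\<close>

definition mean8 :: "('n::finite \<Rightarrow> 'n \<Rightarrow> 'n \<Rightarrow> 'n \<Rightarrow> real) \<Rightarrow> real" where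
  "mean8 S = (\<Sum>i\<in>UNIV. S i i i i) / real CARD('n)"

definition mean62 :: "('n::finite \<Rightarrow> 'n \<Rightarrow> 'n \<Rightarrow> 'n \<Rightarrow> real) \<Rightarrow> real" where
  "mean62 S = (\<Sum>i\<in>UNIV. \<Sum>j\<in>UNIV. S i i i j) / real CARD('n) ^ 2"

definition mean44 :: "('n::finite \<Rightarrow> 'n \<Rightarrow> 'n \<Rightarrow> 'n \<Rightarrow> real) \<Rightarrow> real" where
  "mean44 S = (\<Sum>i\<in>UNIV. \<Sum>j\<in>UNIV. S i i j j) / real CARD('n) ^ 2"

definition mean422 :: "('n::finite \<Rightarrow> 'n \<Rightarrow> 'n \<Rightarrow> 'n \<Rightarrow> real) \<Rightarrow> real" where
  "mean422 S = (\<Sum>i\<in>UNIV. \<Sum>j\<in>UNIV. \<Sum>k\<in>UNIV. S i i j k) / real CARD('n) ^ 3"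

definition mean2222 :: "('n::finite \<Rightarrow> 'n \<Rightarrow> 'n \<Rightarrow> 'n \<Rightarrow> real) \<Rightarrow> real" where
  "mean2222 S = (\<Sum>i\<in>UNIV. \<Sum>j\<in>UNIV. \<Sum>k\<in>UNIV. \<Sum>l\<in>UNIV. S i j k l) / real CARD('n) ^ 4"

lemma mean_pattern:
  fixes \<alpha> \<beta> \<gamma> \<epsilon> \<zeta> :: real
  defines "S \<equiv> pattern \<alpha> \<beta> \<gamma> \<epsilon> \<zeta> :: 'n::finite \<Rightarrow> 'n \<Rightarrow> 'n \<Rightarrow> 'n \<Rightarrow> real"
    and "N \<equiv> real CARD('n)"
  shows "mean8 S = \<alpha> + 6 * \<beta> + 3 * \<gamma> + 4 * \<epsilon> + \<zeta>"
    "mean62 S = (\<alpha> + 3 * \<beta> + \<epsilon>) + (3 * \<beta> + 3 * \<gamma> + 3 * \<epsilon> + \<zeta>) / N"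
    "mean44 S = (\<alpha> + 2 * \<beta> + \<gamma>) + (4 * \<beta> + 2 * \<gamma> + 4 * \<epsilon> + \<zeta>) / N"
    "mean422 S = (\<alpha> + \<beta>) + (5 * \<beta> + \<gamma> + 2 * \<epsilon>) / N + (2 * \<gamma> + 2 * \<epsilon> + \<zeta>) / N^2"
    "mean2222 S = \<alpha> + 6 * \<beta> / N + (3 * \<gamma> + 4 * \<epsilon>) / N^2 + \<zeta> / N^3"
proof -
  have "N > 0"
    by (simp add: N_def)
  then show "mean8 S = \<alpha> + 6 * \<beta> + 3 * \<gamma> + 4 * \<epsilon> + \<zeta>"
    "mean62 S = (\<alpha> + 3 * \<beta> + \<epsilon>) + (3 * \<beta> + 3 * \<gamma> + 3 * \<epsilon> + \<zeta>) / N"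
    "mean44 S = (\<alpha> + 2 * \<beta> + \<gamma>) + (4 * \<beta> + 2 * \<gamma> + 4 * \<epsilon> + \<zeta>) / N"
    "mean422 S = (\<alpha> + \<beta>) + (5 * \<beta> + \<gamma> + 2 * \<epsilon>) / N + (2 * \<gamma> + 2 * \<epsilon> + \<zeta>) / N^2"
    "mean2222 S = \<alpha> + 6 * \<beta> / N + (3 * \<gamma> + 4 * \<epsilon>) / N^2 + \<zeta> / N^3"
    unfolding mean8_def mean62_def mean44_def mean422_def mean2222_def S_def pattern_total
      N_def [symmetric]
    by (simp_all add: field_simps power2_eq_square power3_eq_cube power4_eq_xxxx)
qed

text \<open>The left sides carry the coefficients of \<open>B3\<close>, \<open>B6\<close> and
  \<open>B7\<close>. For \<open>B6\<close> they come from Moebius inversion over coincidences: the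
  sum over all quadruples is reduced to the one over distinct quadruples, where only \<alpha> is
  seen. The common factor is the proportion of such quadruples.\<close>

lemma mean_pattern_combinations:
  fixes \<alpha> \<beta> \<gamma> \<epsilon> \<zeta> :: real
  defines "S \<equiv> pattern \<alpha> \<beta> \<gamma> \<epsilon> \<zeta> :: 'n::finite \<Rightarrow> 'n \<Rightarrow> 'n \<Rightarrow> 'n \<Rightarrow> real"
    and "N \<equiv> real CARD('n)"
  shows "(- N + 1) / N^2 * mean8 S + (4 * N - 4) / N^2 * mean62 S
      + (N^2 - 3 * N + 3) / N^2 * mean44 S - 2 * mean422 S + mean2222 S
      = (N - 1) * (N - 2) * (N - 3) / N^3 * \<gamma>"
    "mean2222 S - 6 / N * mean422 S + 3 / N^2 * mean44 S + 8 / N^2 * mean62 S - 6 / N^3 * mean8 S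
      = (N - 1) * (N - 2) * (N - 3) / N^3 * \<alpha>"
    "2 / N^2 * mean8 S - (2 * N + 2) / N^2 * mean62 S - 1 / N * mean44 S
      + (N + 3) / N * mean422 S - mean2222 S
      = (N - 1) * (N - 2) * (N - 3) / N^3 * \<beta>"
proof -
  have "N > 0"
    by (simp add: N_def)
  then show "(- N + 1) / N^2 * mean8 S + (4 * N - 4) / N^2 * mean62 S
      + (N^2 - 3 * N + 3) / N^2 * mean44 S - 2 * mean422 S + mean2222 S
      = (N - 1) * (N - 2) * (N - 3) / N^3 * \<gamma>"
    "mean2222 S - 6 / N * mean422 S + 3 / N^2 * mean44 S + 8 / N^2 * mean62 S - 6 / N^3 * mean8 S
      = (N - 1) * (N - 2) * (N - 3) / N^3 * \<alpha>"
    "2 / N^2 * mean8 S - (2 * N + 2) / N^2 * mean62 S - 1 / N * mean44 S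
      + (N + 3) / N * mean422 S - mean2222 S
      = (N - 1) * (N - 2) * (N - 3) / N^3 * \<beta>"
    unfolding S_def mean_pattern N_def [symmetric]
    by (simp_all add: field_simps power2_eq_square power3_eq_cube power4_eq_xxxx)
qed

section \<open>Orthogonal splitting of the coefficients of a quartic\<close>

text \<open>The three parts of \<open>u\<close> belong to different types under permutations, so no
  cross terms appear; they produce the terms of \<open>B1\<close>, \<open>B2\<close> and
  \<open>B3\<close>. The witnesses are quantified before the pattern because the same ones must
  serve the coefficient arrays of all monomials.\<close>

lemma even_part_decomposition:
  fixes u :: "'n::finite \<Rightarrow> 'n \<Rightarrow> real"
  assumes card: "CARD('n) \<ge> 4" and sym: "\<And>i j. u i j = u j i"
  shows "\<exists>s w a b c e. (\<forall>x y. 0 \<le> a * x^2 + 2 * b * x * y + c * y^2) \<and> 0 \<le> e \<and>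
    (\<forall>\<alpha> \<beta> \<gamma> \<epsilon> \<zeta>. let S = pattern \<alpha> \<beta> \<gamma> \<epsilon> \<zeta> in
      (\<Sum>i\<in>UNIV. \<Sum>j\<in>UNIV. \<Sum>k\<in>UNIV. \<Sum>l\<in>UNIV. u i j * u k l * S i j k l)
      = s^2 * mean44 S + 2 * s * w * mean422 S + w^2 * mean2222 S
        + a * (mean422 S - mean2222 S) + 2 * b * (mean62 S - mean422 S) + c * (mean8 S - mean44 S)
        + e * \<gamma>)"
proof -
  define N where "N = real CARD('n)"
  have N: "N \<ge> 4"
    using card by (simp add: N_def)
  \<comment> \<open>Off the diagonal, \<open>u i j\<close> is fitted by
    \<open>b0 + b i + b j\<close>: \<open>t\<close> and \<open>b0\<close> are the means of the
    diagonal and of the off-diagonal entries, and \<open>b i\<close> is chosen so that the fit has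
    the off-diagonal row sums \<open>q i\<close>. The divisor \<open>N - 2\<close> arises because
    the \<open>b j\<close> with \<open>j\<close> different from \<open>i\<close> add up to
    \<open>- b i\<close>.\<close>
  define d where "d i = u i i" for i
  define q where "q i = (\<Sum>j\<in>UNIV. u i j) - d i" for i
  define t where "t = (\<Sum>i\<in>UNIV. d i) / N"
  define b0 where "b0 = (\<Sum>i\<in>UNIV. q i) / (N * (N - 1))"
  define b where "b i = (q i - (N - 1) * b0) / (N - 2)" for i
  \<comment> \<open>Removing the constant part and the remainder from \<open>u\<close> leaves
    diagonal entries \<open>d i - t\<close> and off-diagonal entries \<open>b i + b j\<close>. The
    corresponding quartic is the sum over \<open>i\<close> of \<open>\<psi> i\<close> times
    \<open>power_mean 2 * X i ^ 2\<close> plus \<open>\<phi> i\<close> times \<open>X i ^ 4\<close>;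
    the doubling of \<open>b i\<close> on the diagonal is subtracted in
    \<open>\<phi>\<close>.\<close>
  define \<psi> where "\<psi> i = 2 * N * b i" for i
  define \<phi> where "\<phi> i = d i - t - 2 * b i" for i
  \<comment> \<open>The remainder has zero diagonal and zero row sums, so only the two pairings of
    (i,j) with (k,l) see it; this gives the term \<open>2 * Wr * \<gamma>\<close>.\<close>
  define r where "r i j = (if i = j then 0 else u i j - b0 - b i - b j)" for i j
  define Sb where "Sb = (\<Sum>i\<in>UNIV. b i ^ 2)"
  define Sdb where "Sdb = (\<Sum>i\<in>UNIV. d i * b i)"
  define Sd where "Sd = (\<Sum>i\<in>UNIV. d i ^ 2)"
  define W where "W = (\<Sum>i\<in>UNIV. \<Sum>j\<in>UNIV. u i j ^ 2)"
  define Wr where "Wr = (\<Sum>i\<in>UNIV. \<Sum>j\<in>UNIV. r i j ^ 2)"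
  have sum_d: "(\<Sum>i\<in>UNIV. d i) = N * t"
    using N by (simp add: t_def)
  have sum_q: "(\<Sum>i\<in>UNIV. q i) = N * (N - 1) * b0"
    using N by (simp add: b0_def)
  have q: "q i = (N - 1) * b0 + (N - 2) * b i" for i
    using N by (simp add: b_def)
  have sum_b: "(\<Sum>i\<in>UNIV. b i) = 0"
    using sum_q N unfolding q by (simp add: sum.distrib N_def [symmetric] sum_distrib_left [symmetric] mult.assoc)
  have row: "(\<Sum>j\<in>UNIV. u i j) = d i + (N - 1) * b0 + (N - 2) * b i" for i
    using q [of i] by (simp add: q_def)
  have rows: "(\<Sum>i\<in>UNIV. \<Sum>j\<in>UNIV. u i j) = N * t + N * (N - 1) * b0"
    by (simp add: row sum.distrib sum_d N_def [symmetric] sum_distrib_left [symmetric] sum_b)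
  have row2: "(\<Sum>i\<in>UNIV. (\<Sum>j\<in>UNIV. u i j) ^ 2) =
      Sd + N * (N - 1)^2 * b0^2 + (N - 2)^2 * Sb + 2 * N * (N - 1) * b0 * t + 2 * (N - 2) * Sdb"
  proof -
    have "(\<Sum>j\<in>UNIV. u i j) ^ 2 = d i ^ 2 + (N - 1)^2 * b0^2 + (N - 2)^2 * b i ^ 2
        + 2 * (N - 1) * b0 * d i + 2 * (N - 2) * (d i * b i) + 2 * (N - 1) * b0 * (N - 2) * b i" for i
      unfolding row by (simp add: power2_eq_square algebra_simps)
    then show ?thesis
      by (simp add: sum.distrib N_def [symmetric] sum_distrib_left [symmetric] sum_b sum_d Sd_def Sb_def Sdb_def)
  qed
  have row_d: "(\<Sum>i\<in>UNIV. d i * (\<Sum>j\<in>UNIV. u i j)) = Sd + N * (N - 1) * b0 * t + (N - 2) * Sdb"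
  proof -
    have "d i * (\<Sum>j\<in>UNIV. u i j) = d i ^ 2 + (N - 1) * b0 * d i + (N - 2) * (d i * b i)" for i
      unfolding row by (simp add: power2_eq_square algebra_simps)
    then show ?thesis
      by (simp add: sum.distrib N_def [symmetric] sum_distrib_left [symmetric] sum_b sum_d Sd_def Sb_def Sdb_def)
  qed
  have W: "W = Sd + N * (N - 1) * b0^2 + 2 * (N - 2) * Sb + Wr"
  proof -
    \<comment> \<open>The fitted formula is used on the diagonal as well and its square is
      subtracted there, so that all sums run over the full square of indices.\<close>
    have "r i j ^ 2 = (u i j - b0 - b i - b j) ^ 2 - of_bool (i = j) * (d i - b0 - 2 * b i) ^ 2" for i j
      by (simp add: r_def d_def)
    also have "\<dots> i j = u i j ^ 2 + b0^2 + b i ^ 2 + b j ^ 2 - 2 * b0 * u i j - 2 * b i * u i j - 2 * b j * u i j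
       + 2 * b0 * b i + 2 * b0 * b j + 2 * b i * b j - (if i = j then (d i - b0 - 2 * b i) ^ 2 else 0)" for i j
      by (simp add: power2_eq_square algebra_simps)
    finally have r2: "r i j ^ 2 = u i j ^ 2 + b0^2 + b i ^ 2 + b j ^ 2 - 2 * b0 * u i j - 2 * (b i * u i j)
       - 2 * (b j * u i j) + 2 * b0 * b i + 2 * b0 * b j + 2 * (b i * b j)
       - (if i = j then (d i - b0 - 2 * b i) ^ 2 else 0)" for i j
      by simp
    have bu: "(\<Sum>i\<in>UNIV. \<Sum>j\<in>UNIV. b i * u i j) = Sdb + (N - 2) * Sb"
    proof -
      have "(\<Sum>j\<in>UNIV. b i * u i j) = d i * b i + (N - 1) * b0 * b i + (N - 2) * b i ^ 2" for i
        unfolding sum_distrib_left [symmetric] row by (simp add: power2_eq_square algebra_simps)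
      then show ?thesis
        by (simp add: sum.distrib sum_distrib_left [symmetric] sum_b Sb_def Sdb_def)
    qed
    have bu': "(\<Sum>i\<in>UNIV. \<Sum>j\<in>UNIV. b j * u i j) = Sdb + (N - 2) * Sb"
      using bu by (subst sum.swap) (simp add: sym)
    have diag: "(\<Sum>i\<in>UNIV. (d i - b0 - 2 * b i) ^ 2) = Sd + N * b0^2 + 4 * Sb - 2 * N * b0 * t - 4 * Sdb"
    proof -
      have "(d i - b0 - 2 * b i) ^ 2 = d i ^ 2 + b0^2 + 4 * b i ^ 2 - 2 * b0 * d i - 4 * (d i * b i) + 4 * b0 * b i" for i
        by (simp add: power2_eq_square algebra_simps)
      then show ?thesis
        by (simp add: sum.distrib sum_subtractf sum_distrib_left [symmetric] sum_b sum_d N_def [symmetric] Sb_def Sdb_def Sd_def)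
    qed
    have "Wr = W + N^2 * b0^2 + 2 * N * Sb - 2 * b0 * (N * t + N * (N - 1) * b0) - 4 * (Sdb + (N - 2) * Sb)
        - (Sd + N * b0^2 + 4 * Sb - 2 * N * b0 * t - 4 * Sdb)"
      unfolding Wr_def W_def r2
      by (simp add: sum.distrib sum_subtractf sum_distrib_left [symmetric] sum_b N_def [symmetric] rows bu'
          bu [unfolded sum_distrib_left [symmetric]]
          diag Sb_def [symmetric] power2_eq_square [of N])
    then show ?thesis
      by (simp add: power2_eq_square algebra_simps)
  qed
  \<comment> \<open>For weights with sum zero, the average over permutations of a product of two
    weighted sums is the inner product of the weights times N/(N-1) times a covariance. The entries
    of \<open>B2\<close> are the covariances of \<open>power_mean 2 * X i ^ 2\<close> and
    \<open>X i ^ 4\<close>.\<close>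
  define K where "K = N / (N - 1)"
  have K: "K > 0"
    using N by (simp add: K_def)
  have sum_\<psi>: "(\<Sum>i\<in>UNIV. \<psi> i ^ 2) = 4 * N^2 * Sb"
    by (simp add: \<psi>_def power_mult_distrib sum_distrib_left [symmetric] Sb_def)
  have sum_\<phi>: "(\<Sum>i\<in>UNIV. \<phi> i ^ 2) = Sd - N * t^2 - 4 * Sdb + 4 * Sb"
  proof -
    have "\<phi> i ^ 2 = d i ^ 2 + t^2 + 4 * b i ^ 2 - 2 * t * d i - 4 * (d i * b i) + 4 * t * b i" for i
      by (simp add: \<phi>_def power2_eq_square algebra_simps)
    then show ?thesis
      by (simp add: sum.distrib sum_subtractf sum_distrib_left [symmetric] sum_b sum_d N_def [symmetric]
          Sb_def Sdb_def Sd_def) (simp add: power2_eq_square)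
  qed
  have sum_\<psi>\<phi>: "(\<Sum>i\<in>UNIV. \<psi> i * \<phi> i) = 2 * N * (Sdb - 2 * Sb)"
  proof -
    have "\<psi> i * \<phi> i = 2 * N * (d i * b i) - 2 * N * t * b i - 4 * N * b i ^ 2" for i
      by (simp add: \<psi>_def \<phi>_def power2_eq_square algebra_simps)
    then show ?thesis
      by (simp add: sum.distrib sum_subtractf sum_distrib_left [symmetric] sum_b Sb_def Sdb_def right_diff_distrib)
  qed
  \<comment> \<open>The three coefficients form a positive multiple of the Gram matrix of
    \<open>\<psi>\<close> and \<open>\<phi>\<close>.\<close>
  have "0 \<le> K * (\<Sum>i\<in>UNIV. \<psi> i ^ 2) * x^2 + 2 * (K * (\<Sum>i\<in>UNIV. \<psi> i * \<phi> i)) * x * y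
      + K * (\<Sum>i\<in>UNIV. \<phi> i ^ 2) * y^2" for x y
  proof -
    have "K * (\<Sum>i\<in>UNIV. \<psi> i ^ 2) * x^2 + 2 * (K * (\<Sum>i\<in>UNIV. \<psi> i * \<phi> i)) * x * y
      + K * (\<Sum>i\<in>UNIV. \<phi> i ^ 2) * y^2 = K * (\<Sum>i\<in>UNIV. (\<psi> i * x + \<phi> i * y)^2)"
      by (simp add: power2_eq_square algebra_simps sum.distrib sum_distrib_left)
    also have "\<dots> \<ge> 0"
      using K by (intro mult_nonneg_nonneg sum_nonneg) auto
    finally show ?thesis .
  qed
  moreover have "0 \<le> 2 * Wr"
    by (simp add: Wr_def sum_nonneg)
  moreover have "(\<Sum>i\<in>UNIV. \<Sum>j\<in>UNIV. \<Sum>k\<in>UNIV. \<Sum>l\<in>UNIV. u i j * u k l * S i j k l)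
      = (N * (t - b0))^2 * mean44 S + 2 * (N * (t - b0)) * (N^2 * b0) * mean422 S + (N^2 * b0)^2 * mean2222 S
        + K * (\<Sum>i\<in>UNIV. \<psi> i ^ 2) * (mean422 S - mean2222 S)
        + 2 * (K * (\<Sum>i\<in>UNIV. \<psi> i * \<phi> i)) * (mean62 S - mean422 S)
        + K * (\<Sum>i\<in>UNIV. \<phi> i ^ 2) * (mean8 S - mean44 S)
        + 2 * Wr * \<gamma>" if S: "S = pattern \<alpha> \<beta> \<gamma> \<epsilon> \<zeta>" for S \<alpha> \<beta> \<gamma> \<epsilon> \<zeta>
  proof -
    \<comment> \<open>Of the six \<beta> sums, two pair the trace with the total and four give
      squared row sums; of the three \<gamma> sums, one is the squared trace and two are
      \<open>W\<close>. Symmetry of \<open>u\<close> is used here.\<close>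
    have "(\<Sum>i\<in>UNIV. \<Sum>j\<in>UNIV. \<Sum>k\<in>UNIV. \<Sum>l\<in>UNIV. u i j * u k l * S i j k l)
      = \<alpha> * (\<Sum>i\<in>UNIV. \<Sum>j\<in>UNIV. u i j)^2
        + \<beta> * (2 * (\<Sum>i\<in>UNIV. d i) * (\<Sum>i\<in>UNIV. \<Sum>j\<in>UNIV. u i j) + 4 * (\<Sum>i\<in>UNIV. (\<Sum>j\<in>UNIV. u i j) ^ 2))
        + \<gamma> * ((\<Sum>i\<in>UNIV. d i)^2 + 2 * W)
        + 4 * \<epsilon> * (\<Sum>i\<in>UNIV. d i * (\<Sum>j\<in>UNIV. u i j)) + \<zeta> * Sd"
    proof -
      define R where "R i = (\<Sum>j\<in>UNIV. u i j)" for i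
      have col: "(\<Sum>i\<in>UNIV. u i j) = R j" for j
        by (simp add: R_def sym [of _ j])
      have pull: "(\<Sum>j\<in>UNIV. x * h j) = x * (\<Sum>j\<in>UNIV. h j)"
        "(\<Sum>j\<in>UNIV. h j * x) = (\<Sum>j\<in>UNIV. h j) * x" for x and h :: "'n \<Rightarrow> real"
        by (simp_all only: sum_distrib_left sum_distrib_right)
      have swap: "(\<Sum>i\<in>UNIV. \<Sum>j\<in>UNIV. \<Sum>k\<in>UNIV. u i j * h j k) = (\<Sum>j\<in>UNIV. R j * (\<Sum>k\<in>UNIV. h j k))"
        "(\<Sum>i\<in>UNIV. \<Sum>j\<in>UNIV. u i j * g j) = (\<Sum>j\<in>UNIV. R j * g j)"
        for h :: "'n \<Rightarrow> 'n \<Rightarrow> real" and g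
        by (subst sum.swap, simp only: pull col)+
      have mirror: "u i j * u j i = u i j * u i j" for i j
        using sym [of j i] by simp
      show ?thesis
        unfolding S sum_mult_pattern swap mirror
        unfolding pull R_def [symmetric] col
        by (simp add: d_def [symmetric] W_def Sd_def power2_eq_square algebra_simps)
    qed
    also have "\<dots> = \<alpha> * (N * t + N * (N - 1) * b0)^2
        + \<beta> * (2 * (N * t) * (N * t + N * (N - 1) * b0) + 4 * (Sd + N * (N - 1)^2 * b0^2 + (N - 2)^2 * Sb
              + 2 * N * (N - 1) * b0 * t + 2 * (N - 2) * Sdb))
        + \<gamma> * ((N * t)^2 + 2 * (Sd + N * (N - 1) * b0^2 + 2 * (N - 2) * Sb + Wr))
        + 4 * \<epsilon> * (Sd + N * (N - 1) * b0 * t + (N - 2) * Sdb) + \<zeta> * Sd"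
      by (simp only: rows row2 row_d W sum_d)
    \<comment> \<open>\<open>N * (t - b0)\<close> and \<open>N^2 * b0\<close> are the coefficients
      of \<open>power_mean 4\<close> and of the square of \<open>power_mean 2\<close> in the
      constant part of \<open>u\<close>. The factors after the other terms are arranged to be
      \<open>K\<close> times the entries of \<open>B2\<close>.\<close>
    also have "\<dots> = (N * (t - b0))^2 * mean44 S + 2 * (N * (t - b0)) * (N^2 * b0) * mean422 S + (N^2 * b0)^2 * mean2222 S
        + 4 * N^2 * Sb * (\<beta> + (\<gamma> + 2 * \<epsilon>) / N + \<zeta> / N^2)
        + 4 * N * (Sdb - 2 * Sb) * (2 * \<beta> + \<epsilon> + (2 * \<gamma> + 2 * \<epsilon> + \<zeta>) / N)
        + (Sd - N * t^2 - 4 * Sdb + 4 * Sb) * (4 * \<beta> + 2 * \<gamma> + 4 * \<epsilon> + \<zeta>)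
        + 2 * Wr * \<gamma>"
      using N unfolding S mean_pattern N_def [symmetric]
      by (simp add: field_simps power2_eq_square power3_eq_cube)
    also have "\<beta> + (\<gamma> + 2 * \<epsilon>) / N + \<zeta> / N^2 = K * (mean422 S - mean2222 S)"
      using N unfolding S mean_pattern N_def [symmetric] K_def
      by (simp add: field_simps power2_eq_square power3_eq_cube)
    also have "2 * \<beta> + \<epsilon> + (2 * \<gamma> + 2 * \<epsilon> + \<zeta>) / N = K * (mean62 S - mean422 S)"
      using N unfolding S mean_pattern N_def [symmetric] K_def
      by (simp add: field_simps power2_eq_square power3_eq_cube)
    also have "4 * \<beta> + 2 * \<gamma> + 4 * \<epsilon> + \<zeta> = K * (mean8 S - mean44 S)"
      using N unfolding S mean_pattern N_def [symmetric] K_def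
      by (simp add: field_simps power2_eq_square power3_eq_cube)
    finally show ?thesis
      unfolding sum_\<psi> sum_\<phi> sum_\<psi>\<phi> by (simp add: mult_ac)
  qed
  ultimately show ?thesis
    unfolding Let_def by blast
qed

text \<open>Here \<open>g\<close> is the mean of \<open>v\<close> away from \<open>i0\<close> and
  \<open>j0\<close>, while \<open>s\<close> and \<open>t\<close> are the symmetric and antisymmetric
  excess at these two indices. The swap of \<open>i0\<close> and \<open>j0\<close> isolates
  \<open>t\<close>, and the deviations from \<open>g\<close> have sum zero, so cross terms with them
  vanish. What remains are the terms of \<open>B4\<close>, \<open>B5\<close> and \<open>B7\<close>;
  the first is the one for the vector \<open>(N * g, s)\<close>.\<close>

lemma pair_part_decomposition:
  fixes v :: "'n::finite \<Rightarrow> real"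
  assumes card: "CARD('n) \<ge> 4" and "i0 \<noteq> j0" and S: "S = pattern \<alpha> \<beta> \<gamma> \<epsilon> \<zeta>"
  defines "N \<equiv> real CARD('n)"
  defines "g \<equiv> ((\<Sum>k\<in>UNIV. v k) - v i0 - v j0) / (N - 2)"
  defines "s \<equiv> (v i0 + v j0) / 2 - g"
    and "t \<equiv> (v i0 - v j0) / 2"
    and "e \<equiv> \<Sum>k\<in>- {i0, j0}. (v k - g)^2"
  shows "(\<Sum>k\<in>UNIV. \<Sum>l\<in>UNIV. v k * v l * S i0 j0 k l)
      = N / (N - 1) * ((N * g)^2 * (mean2222 S - 1 / N * mean422 S)
          + 2 * (N * g * s) * (2 * mean422 S - 2 / N * mean62 S)
          + s^2 * (2 * mean62 S + 2 * mean44 S - 4 / N * mean8 S))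
        + 2 * N / (N - 1) * t^2 * (mean62 S - mean44 S) + e * \<beta>"
proof -
  have N: "N \<ge> 4"
    using card by (simp add: N_def)
  have total: "(\<Sum>k\<in>UNIV. v k) = 2 * s + N * g"
  proof -
    have "(N - 2) * g = (\<Sum>k\<in>UNIV. v k) - v i0 - v j0"
      using N by (simp add: g_def)
    then show ?thesis
      by (simp add: s_def field_simps)
  qed
  have split: "(\<Sum>k\<in>UNIV. h k) = h i0 + h j0 + (\<Sum>k\<in>- {i0, j0}. h k)" for h :: "'n \<Rightarrow> real"
  proof -
    have "(\<Sum>k\<in>UNIV. h k) = (\<Sum>k\<in>{i0, j0}. h k) + (\<Sum>k\<in>- {i0, j0}. h k)"
      by (subst sum.union_disjoint [symmetric]) (auto intro: sum.cong)
    then show ?thesis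
      using \<open>i0 \<noteq> j0\<close> by simp
  qed
  have v: "v i0 = s + g + t" "v j0 = s + g - t"
    by (simp_all add: s_def t_def field_simps)
  have rest: "real (card (- {i0, j0})) = N - 2"
    using split [of "\<lambda>_. 1"] by (simp add: N_def)
  have squares: "(\<Sum>k\<in>UNIV. v k ^ 2) = e + 2 * (s + g)^2 + 2 * t^2 + (N - 2) * g^2"
  proof -
    have "e = (\<Sum>k\<in>- {i0, j0}. v k ^ 2 - 2 * g * v k + g^2)"
      unfolding e_def by (rule sum.cong) (simp_all add: power2_eq_square algebra_simps)
    also have "\<dots> = (\<Sum>k\<in>- {i0, j0}. v k ^ 2) - 2 * g * (\<Sum>k\<in>- {i0, j0}. v k) + (N - 2) * g^2"
      by (simp add: sum.distrib sum_subtractf sum_distrib_left [symmetric] rest)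
    also have "(\<Sum>k\<in>- {i0, j0}. v k) = (N - 2) * g"
      using total split [of v] by (simp add: v algebra_simps)
    finally show ?thesis
      using split [of "\<lambda>k. v k ^ 2"] by (simp add: v power2_eq_square algebra_simps)
  qed
  let ?T = "\<Sum>k\<in>UNIV. v k"
  have delta: "(\<Sum>k\<in>UNIV. h k * of_bool (i = k)) = h i" for h :: "'n \<Rightarrow> real" and i
    by (simp add: of_bool_def if_distrib cong: if_cong)
  have pull: "(\<Sum>j\<in>UNIV. x * h j) = x * (\<Sum>j\<in>UNIV. h j)"
    "(\<Sum>j\<in>UNIV. h j * x) = (\<Sum>j\<in>UNIV. h j) * x" for x and h :: "'n \<Rightarrow> real"
    by (simp_all only: sum_distrib_left sum_distrib_right)
  \<comment> \<open>As \<open>i0\<close> differs from \<open>j0\<close>, every delta identifying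
    them drops out, and \<zeta> with it. The summands are written as a function of \<open>k\<close>
    times one of \<open>l\<close>, except for the single delta linking the two.\<close>
  have expand: "v k * v l * S i0 j0 k l = (\<alpha> * v k) * v l
    + (\<beta> * v k * of_bool (i0 = k)) * v l + (\<epsilon> * v k * of_bool (i0 = k)) * (v l * of_bool (i0 = l))
    + (\<beta> * v k * of_bool (j0 = k)) * v l + (\<epsilon> * v k * of_bool (j0 = k)) * (v l * of_bool (j0 = l))
    + (\<beta> * v k) * (v l * of_bool (i0 = l)) + (\<beta> * v k) * (v l * of_bool (j0 = l))
    + (\<beta> * v k) * (v l * of_bool (k = l))
    + (\<gamma> * v k * of_bool (i0 = k)) * (v l * of_bool (j0 = l))
    + (\<gamma> * v k * of_bool (j0 = k)) * (v l * of_bool (i0 = l))" for k l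
    using \<open>i0 \<noteq> j0\<close> by (auto simp: S pattern_def of_bool_def algebra_simps)
  have inner: "(\<Sum>l\<in>UNIV. v k * v l * S i0 j0 k l) = (\<alpha> * ?T + \<beta> * (v i0 + v j0)) * v k + \<beta> * v k ^ 2
    + (\<beta> * ?T + \<epsilon> * v i0 + \<gamma> * v j0) * (v k * of_bool (i0 = k))
    + (\<beta> * ?T + \<epsilon> * v j0 + \<gamma> * v i0) * (v k * of_bool (j0 = k))" for k
    unfolding expand sum.distrib pull delta by (simp add: power2_eq_square algebra_simps)
  have "(\<Sum>k\<in>UNIV. \<Sum>l\<in>UNIV. v k * v l * S i0 j0 k l)
    = \<alpha> * ?T^2 + \<beta> * (2 * (v i0 + v j0) * ?T + (\<Sum>k\<in>UNIV. v k ^ 2)) + 2 * \<gamma> * v i0 * v j0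
      + \<epsilon> * (v i0 ^ 2 + v j0 ^ 2)"
    unfolding inner sum.distrib pull delta by (simp add: power2_eq_square algebra_simps)
  also have "\<dots> = N / (N - 1) * ((N * g)^2 * (mean2222 S - 1 / N * mean422 S)
        + 2 * (N * g * s) * (2 * mean422 S - 2 / N * mean62 S)
        + s^2 * (2 * mean62 S + 2 * mean44 S - 4 / N * mean8 S))
      + 2 * N / (N - 1) * t^2 * (mean62 S - mean44 S) + e * \<beta>"
  proof -
    \<comment> \<open>The factor N/(N-1) passes from averages over all ordered pairs of indices to
      averages over pairs of distinct ones, which explains the clean right sides.\<close>
    have K: "N / (N - 1) * (mean2222 S - 1 / N * mean422 S)
        = \<alpha> + 5 * \<beta> / N + 2 * (\<gamma> + \<epsilon>) / N^2"
      "N / (N - 1) * (2 * mean422 S - 2 / N * mean62 S)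
        = 2 * (\<alpha> + \<beta>) + 2 * (3 * \<beta> + \<gamma> + \<epsilon>) / N"
      "N / (N - 1) * (2 * mean62 S + 2 * mean44 S - 4 / N * mean8 S)
        = 2 * (\<alpha> + 3 * \<beta> + \<epsilon>) + 2 * (\<alpha> + 2 * \<beta> + \<gamma>)"
      "N / (N - 1) * (mean62 S - mean44 S) = \<beta> + \<epsilon> - \<gamma>"
      using N unfolding S mean_pattern N_def [symmetric]
      by (simp_all add: field_simps power2_eq_square power3_eq_cube)
    have "N / (N - 1) * ((N * g)^2 * (mean2222 S - 1 / N * mean422 S)
        + 2 * (N * g * s) * (2 * mean422 S - 2 / N * mean62 S)
        + s^2 * (2 * mean62 S + 2 * mean44 S - 4 / N * mean8 S))
      + 2 * N / (N - 1) * t^2 * (mean62 S - mean44 S) + e * \<beta>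
      = (N * g)^2 * (N / (N - 1) * (mean2222 S - 1 / N * mean422 S))
        + 2 * (N * g * s) * (N / (N - 1) * (2 * mean422 S - 2 / N * mean62 S))
        + s^2 * (N / (N - 1) * (2 * mean62 S + 2 * mean44 S - 4 / N * mean8 S))
        + 2 * t^2 * (N / (N - 1) * (mean62 S - mean44 S)) + e * \<beta>"
      by (simp only: distrib_left times_divide_eq_left times_divide_eq_right mult_ac)
    also have "\<dots> = (N * g)^2 * (\<alpha> + 5 * \<beta> / N + 2 * (\<gamma> + \<epsilon>) / N^2)
        + 2 * (N * g * s) * (2 * (\<alpha> + \<beta>) + 2 * (3 * \<beta> + \<gamma> + \<epsilon>) / N)
        + s^2 * (2 * (\<alpha> + 3 * \<beta> + \<epsilon>) + 2 * (\<alpha> + 2 * \<beta> + \<gamma>))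
        + 2 * t^2 * (\<beta> + \<epsilon> - \<gamma>) + e * \<beta>"
      by (simp only: K)
    also have "\<dots> = \<alpha> * ?T^2 + \<beta> * (2 * (v i0 + v j0) * ?T + (\<Sum>k\<in>UNIV. v k ^ 2)) + 2 * \<gamma> * v i0 * v j0
      + \<epsilon> * (v i0 ^ 2 + v j0 ^ 2)"
      using N unfolding total squares v
      by (simp add: field_simps power2_eq_square)
    finally show ?thesis
      by simp
  qed
  finally show ?thesis .
qed

section \<open>Averages of products of squared variables\<close>

definition quad :: "'n \<Rightarrow> 'n \<Rightarrow> 'n \<Rightarrow> 'n \<Rightarrow> ('n::finite) mpoly" where
  "quad i j k l = reynolds (X i ^ 2 * X j ^ 2 * X k ^ 2 * X l ^ 2)"

text \<open>With the monomial fixed, polynomial identities between averages become identities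
  between real arrays, to which the pattern computations apply.\<close>

definition quad_coeff :: "('n \<Rightarrow>\<^sub>0 nat) \<Rightarrow> 'n \<Rightarrow> 'n \<Rightarrow> 'n \<Rightarrow> 'n::finite \<Rightarrow> real" where
  "quad_coeff m i j k l = Poly_Mapping.lookup (quad i j k l) m"

text \<open>Symmetry comes from commutativity of multiplication, invariance from
  \<open>reynolds_act\<close> applied to permutations without sign changes.\<close>

lemma quad_coeff_pattern:
  fixes m :: "('n::finite) \<Rightarrow>\<^sub>0 nat"
  assumes "distinct [a, b, c, d]"
  shows "\<exists>\<epsilon> \<zeta>. quad_coeff m = pattern (quad_coeff m a b c d)
    (quad_coeff m a a b c - quad_coeff m a b c d)
    (quad_coeff m a a b b - 2 * quad_coeff m a a b c + quad_coeff m a b c d) \<epsilon> \<zeta>"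
proof (rule symmetric_invariant_imp_pattern [OF assms])
  fix \<tau> :: "'n \<Rightarrow> 'n" and i j k l
  assume "bij \<tau>"
  then have t: "(\<tau>, \<lambda>_. 1) \<in> signed_perms"
    by (simp add: signed_perms_def)
  show "quad_coeff m (\<tau> i) (\<tau> j) (\<tau> k) (\<tau> l) = quad_coeff m i j k l"
    using reynolds_act [OF t, of "X i ^ 2 * X j ^ 2 * X k ^ 2 * X l ^ 2"]
    by (simp add: quad_coeff_def quad_def act_simps)
qed (simp_all add: quad_coeff_def quad_def mult_ac)

lemma quad_coeff_obtain_pattern:
  fixes m :: "('n::finite) \<Rightarrow>\<^sub>0 nat"
  assumes "CARD('n) \<ge> 4"
  obtains \<alpha> \<beta> \<gamma> \<epsilon> \<zeta> where "quad_coeff m = pattern \<alpha> \<beta> \<gamma> \<epsilon> \<zeta>"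
proof -
  obtain A :: "'n set" where "card A = 4"
    using assms obtain_subset_with_card_n by metis
  then obtain xs :: "'n list" where "distinct xs" "length xs = 4"
    by (metis card.infinite distinct_card finite_distinct_list zero_neq_numeral)
  then obtain a b c d :: 'n where "distinct [a, b, c, d]"
    by (auto simp: length_Suc_conv numeral_eq_Suc)
  from quad_coeff_pattern [OF this] that show thesis
    by blast
qed

text \<open>Even exponents absorb the signs, and the permutation only reindexes the sum.\<close>

lemma act_power_mean:
  assumes "t \<in> signed_perms" "even k"
  shows "act t (power_mean k) = power_mean k"
proof -
  have sgn: "snd t i \<in> {1, -1}" and bij: "bij (fst t)" for i
    using assms(1) by (auto simp: signed_perms_def)
  have "snd t i ^ k = 1" for i
    using sgn [of i] assms(2) by auto
  then have "act t (X i ^ k) = X (fst t i) ^ k" for i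
    by (simp add: act_simps power_mult_distrib Const_power [symmetric])
  then show ?thesis
    using sum.reindex_bij_betw [OF bij, of "\<lambda>i. X i ^ k"]
    by (simp add: power_mean_def act_simps(4,6,7))
qed

lemma reynolds_p:
  assumes "\<forall>k\<in>set ks. even k"
  shows "reynolds (p ks) = p ks"
proof (rule reynolds_fixed)
  fix t :: "('a \<Rightarrow> 'a) \<times> ('a \<Rightarrow> real)"
  assume t: "t \<in> signed_perms"
  show "act t (p ks) = p ks"
    using assms
  proof (induction ks)
    case Nil
    then show ?case
      using act_simps(6) [of t 1] by (simp add: p_def)
  next
    case (Cons k ks)
    then show ?case
      using act_power_mean [OF t, of k] by (simp add: p_def act_simps)
  qed
qed

lemma X_power_even:
  "X i ^ 4 = X i ^ 2 * X i ^ 2" "X i ^ 6 = X i ^ 2 * X i ^ 2 * X i ^ 2"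
  "X i ^ 8 = X i ^ 2 * X i ^ 2 * X i ^ 2 * X i ^ 2"
  by (simp_all flip: power_add)

lemma sum_product3:
  fixes a :: "'i \<Rightarrow> 'a::comm_semiring_1"
  shows "sum a A * sum b B * sum c C = (\<Sum>i\<in>A. \<Sum>j\<in>B. \<Sum>k\<in>C. a i * b j * c k)"
proof -
  have "sum a A * sum b B * sum c C = (\<Sum>i\<in>A. \<Sum>j\<in>B. a i * b j * sum c C)"
    by (subst sum_product) (simp only: sum_distrib_right)
  then show ?thesis
    by (simp only: sum_distrib_left)
qed

lemma sum_product4:
  fixes a :: "'i \<Rightarrow> 'a::comm_semiring_1"
  shows "sum a A * sum b B * sum c C * sum d D
    = (\<Sum>i\<in>A. \<Sum>j\<in>B. \<Sum>k\<in>C. \<Sum>l\<in>D. a i * b j * c k * d l)"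
proof -
  have "sum a A * sum b B * sum c C * sum d D
      = (\<Sum>i\<in>A. \<Sum>j\<in>B. \<Sum>k\<in>C. a i * b j * c k * sum d D)"
    by (subst sum_product3) (simp only: sum_distrib_right)
  then show ?thesis
    by (simp only: sum_distrib_left)
qed

text \<open>Each of these products is its own average. Expanding it into a multiple sum and
  averaging term by term turns every summand into a \<open>quad\<close>.\<close>

lemma lookup_p:
  fixes m :: "('n::finite) \<Rightarrow>\<^sub>0 nat"
  shows "Poly_Mapping.lookup (p [8]) m = mean8 (quad_coeff m)"
    "Poly_Mapping.lookup (p [6, 2]) m = mean62 (quad_coeff m)"
    "Poly_Mapping.lookup (p [4, 4]) m = mean44 (quad_coeff m)"
    "Poly_Mapping.lookup (p [4, 2, 2]) m = mean422 (quad_coeff m)"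
    "Poly_Mapping.lookup (p [2, 2, 2, 2]) m = mean2222 (quad_coeff m)"
proof -
  let ?N = "real CARD('n)"
  have "(p [8] :: 'n mpoly) = Const (1 / ?N) * (\<Sum>i\<in>UNIV. X i ^ 8)"
    by (simp add: p_def power_mean_def)
  then have "reynolds (p [8] :: 'n mpoly) = Const (1 / ?N) * (\<Sum>i\<in>UNIV. quad i i i i)"
    by (simp only: reynolds_Const_mult reynolds_sum quad_def X_power_even)
  then show "Poly_Mapping.lookup (p [8]) m = mean8 (quad_coeff m)"
    by (simp add: reynolds_p mean8_def quad_coeff_def lookup_sum)
  have "(p [6, 2] :: 'n mpoly) = Const (1 / ?N) * Const (1 / ?N) * ((\<Sum>i\<in>UNIV. X i ^ 6) * (\<Sum>i\<in>UNIV. X i ^ 2))"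
    by (simp add: p_def power_mean_def mult_ac)
  also have "\<dots> = Const (1 / ?N ^ 2) * (\<Sum>i\<in>UNIV. \<Sum>j\<in>UNIV. X i ^ 6 * X j ^ 2)"
    by (simp add: sum_product Const_mult [symmetric] power2_eq_square)
  finally have "reynolds (p [6, 2] :: 'n mpoly) = Const (1 / ?N ^ 2) * (\<Sum>i\<in>UNIV. \<Sum>j\<in>UNIV. quad i i i j)"
    by (simp only: reynolds_Const_mult reynolds_sum quad_def X_power_even)
  then show "Poly_Mapping.lookup (p [6, 2]) m = mean62 (quad_coeff m)"
    by (simp add: reynolds_p mean62_def quad_coeff_def lookup_sum)
  have "(p [4, 4] :: 'n mpoly) = Const (1 / ?N) * Const (1 / ?N) * ((\<Sum>i\<in>UNIV. X i ^ 4) * (\<Sum>i\<in>UNIV. X i ^ 4))"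
    by (simp add: p_def power_mean_def mult_ac)
  also have "\<dots> = Const (1 / ?N ^ 2) * (\<Sum>i\<in>UNIV. \<Sum>j\<in>UNIV. X i ^ 4 * X j ^ 4)"
    by (simp add: sum_product Const_mult [symmetric] power2_eq_square)
  finally have "reynolds (p [4, 4] :: 'n mpoly) = Const (1 / ?N ^ 2) * (\<Sum>i\<in>UNIV. \<Sum>j\<in>UNIV. quad i i j j)"
    by (simp only: reynolds_Const_mult reynolds_sum quad_def X_power_even mult.assoc)
  then show "Poly_Mapping.lookup (p [4, 4]) m = mean44 (quad_coeff m)"
    by (simp add: reynolds_p mean44_def quad_coeff_def lookup_sum)
  have "(p [4, 2, 2] :: 'n mpoly) = Const (1 / ?N) * Const (1 / ?N) * Const (1 / ?N) *
      ((\<Sum>i\<in>UNIV. X i ^ 4) * (\<Sum>i\<in>UNIV. X i ^ 2) * (\<Sum>i\<in>UNIV. X i ^ 2))"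
    by (simp add: p_def power_mean_def mult_ac)
  also have "\<dots> = Const (1 / ?N ^ 3) * (\<Sum>i\<in>UNIV. \<Sum>j\<in>UNIV. \<Sum>k\<in>UNIV. X i ^ 4 * X j ^ 2 * X k ^ 2)"
    by (simp add: sum_product3 Const_mult [symmetric] power3_eq_cube)
  finally have "reynolds (p [4, 2, 2] :: 'n mpoly) = Const (1 / ?N ^ 3) * (\<Sum>i\<in>UNIV. \<Sum>j\<in>UNIV. \<Sum>k\<in>UNIV. quad i i j k)"
    by (simp only: reynolds_Const_mult reynolds_sum quad_def X_power_even)
  then show "Poly_Mapping.lookup (p [4, 2, 2]) m = mean422 (quad_coeff m)"
    by (simp add: reynolds_p mean422_def quad_coeff_def lookup_sum)
  have "(p [2, 2, 2, 2] :: 'n mpoly) = Const (1 / ?N) * Const (1 / ?N) * Const (1 / ?N) * Const (1 / ?N) *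
      ((\<Sum>i\<in>UNIV. X i ^ 2) * (\<Sum>i\<in>UNIV. X i ^ 2) * (\<Sum>i\<in>UNIV. X i ^ 2) * (\<Sum>i\<in>UNIV. X i ^ 2))"
    by (simp add: p_def power_mean_def mult_ac)
  also have "\<dots> = Const (1 / ?N ^ 4) *
      (\<Sum>i\<in>UNIV. \<Sum>j\<in>UNIV. \<Sum>k\<in>UNIV. \<Sum>l\<in>UNIV. X i ^ 2 * X j ^ 2 * X k ^ 2 * X l ^ 2)"
    by (simp add: sum_product4 Const_mult [symmetric] power4_eq_xxxx)
  finally have "reynolds (p [2, 2, 2, 2] :: 'n mpoly) = Const (1 / ?N ^ 4) *
      (\<Sum>i\<in>UNIV. \<Sum>j\<in>UNIV. \<Sum>k\<in>UNIV. \<Sum>l\<in>UNIV. quad i j k l)"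
    by (simp only: reynolds_Const_mult reynolds_sum quad_def)
  then show "Poly_Mapping.lookup (p [2, 2, 2, 2]) m = mean2222 (quad_coeff m)"
    by (simp add: reynolds_p mean2222_def quad_coeff_def lookup_sum)
qed

section \<open>The cone generated by the matrices\<close>

lemma trace_inner_mat2:
  "trace_inner A (mat2 a b c d)
    = Const (A$1$1) * a + Const (A$1$2) * c + Const (A$2$1) * b + Const (A$2$2) * d"
  by (simp add: trace_inner_def trace_def matrix_matrix_mult_def map_matrix_def mat2_def sum_2 vector_2
      add_ac)

section \<open>Positive semidefinite matrices of size two\<close>

lemma psd_quadratic_form:
  fixes A :: "real ^ 2 ^ 2"
  shows "psd A \<longleftrightarrow> A$1$2 = A$2$1 \<and> (\<forall>x y. 0 \<le> A$1$1 * x^2 + 2 * A$1$2 * x * y + A$2$2 * y^2)"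
proof -
  have form: "v \<bullet> (A *v v) = A$1$1 * (v$1)^2 + (A$1$2 + A$2$1) * v$1 * v$2 + A$2$2 * (v$2)^2" for v
    by (simp add: inner_vec_def matrix_vector_mult_def sum_2 power2_eq_square algebra_simps)
  have sym: "transpose A = A \<longleftrightarrow> A$1$2 = A$2$1"
    by (auto simp: transpose_def vec_eq_iff forall_2)
  show ?thesis
  proof (intro iffI conjI allI)
    assume "psd A"
    then show "A$1$2 = A$2$1"
      by (simp add: psd_def sym)
    fix x y :: real
    have "0 \<le> vector [x, y] \<bullet> (A *v vector [x, y])"
      using \<open>psd A\<close> by (simp add: psd_def)
    then show "0 \<le> A$1$1 * x^2 + 2 * A$1$2 * x * y + A$2$2 * y^2"
      unfolding form using \<open>A$1$2 = A$2$1\<close> by simp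
  next
    assume "A$1$2 = A$2$1 \<and> (\<forall>x y. 0 \<le> A$1$1 * x^2 + 2 * A$1$2 * x * y + A$2$2 * y^2)"
    then show "psd A"
      unfolding psd_def form sym by (metis mult_2)
  qed
qed

lemma psd_mat2:
  "psd (mat2 a b b c) \<longleftrightarrow> (\<forall>x y. 0 \<le> a * x^2 + 2 * b * x * y + c * y^2)"
  by (simp add: psd_quadratic_form mat2_def vector_2)

lemma psd_0 [simp]: "psd (0 :: real ^ 2 ^ 2)"
  by (simp add: psd_quadratic_form)

lemma psd_add:
  fixes A B :: "real ^ 2 ^ 2"
  assumes "psd A" "psd B"
  shows "psd (A + B)"
  unfolding psd_quadratic_form vector_add_component
proof (intro conjI allI)
  show "A$1$2 + B$1$2 = A$2$1 + B$2$1"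
    using assms by (simp add: psd_quadratic_form)
  fix x y :: real
  have "0 \<le> A$1$1 * x^2 + 2 * A$1$2 * x * y + A$2$2 * y^2"
    using assms(1) unfolding psd_quadratic_form by blast
  moreover have "0 \<le> B$1$1 * x^2 + 2 * B$1$2 * x * y + B$2$2 * y^2"
    using assms(2) unfolding psd_quadratic_form by blast
  ultimately show "0 \<le> (A$1$1 + B$1$1) * x^2 + 2 * (A$1$2 + B$1$2) * x * y + (A$2$2 + B$2$2) * y^2"
    by (simp add: algebra_simps)
qed

text \<open>A Cholesky factorisation: \<open>A\<close> is the sum of the rank-one matrices of
  \<open>(x, y)\<close> and \<open>(x', y')\<close>. It reduces pairings with \<open>A\<close> to
  pairings with vectors.\<close>

lemma psd_eq_sum_rank_one:
  fixes A :: "real ^ 2 ^ 2"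
  assumes "psd A"
  obtains x y x' y' where "A$1$1 = x^2 + x'^2" "A$1$2 = x * y + x' * y'"
    "A$2$1 = x * y + x' * y'" "A$2$2 = y^2 + y'^2"
proof -
  define a b c where "a = A$1$1" "b = A$1$2" "c = A$2$2"
  note abc = this
  have A: "A$1$1 = a" "A$1$2 = b" "A$2$1 = b" "A$2$2 = c"
    using assms by (simp_all add: psd_quadratic_form abc)
  have nonneg: "0 \<le> a * x^2 + 2 * b * x * y + c * y^2" for x y
    using assms unfolding psd_quadratic_form abc by blast
  have "a \<ge> 0" "c \<ge> 0"
    using nonneg [of 1 0] nonneg [of 0 1] by simp_all
  show thesis
  proof (cases "a = 0")
    case True
    have "b = 0"
    proof (rule ccontr)
      assume "b \<noteq> 0"
      \<comment> \<open>At this point the quadratic form takes the value -1.\<close>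
      then show False
        using nonneg [of "- (c + 1) / (2 * b)" 1] True by simp
    qed
    with True \<open>c \<ge> 0\<close> show thesis
      by (intro that [of 0 0 "sqrt c" 0]) (simp_all add: A)
  next
    case False
    with \<open>a \<ge> 0\<close> have "a > 0"
      by simp
    \<comment> \<open>The Schur complement, which is the minimum of the form on the line
      \<open>y = 1\<close>; its root is the last entry of the triangular factor.\<close>
    have "0 \<le> c - b^2 / a"
      using nonneg [of "- b / a" 1] \<open>a > 0\<close> by (simp add: field_simps power2_eq_square)
    with \<open>a > 0\<close> show thesis
      by (intro that [of "sqrt a" 0 "b / sqrt a" "sqrt (c - b^2 / a)"]) (simp_all add: A power_divide)
  qed
qed

text \<open>The right side of the theorem as a function of its data, matrices first as in the
  theorem's quantifiers. It is linear in these data, so \<open>octic_cone\<close> is closed under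
  addition.\<close>

definition octic_combination ::
  "real ^ 2 ^ 2 \<Rightarrow> real ^ 2 ^ 2 \<Rightarrow> real ^ 2 ^ 2 \<Rightarrow> real \<Rightarrow> real \<Rightarrow> real \<Rightarrow> real \<Rightarrow> ('n::finite) mpoly" where
  "octic_combination A1 A2 A4 A3 A5 A6 A7 =
     trace_inner A1 B1 + trace_inner A2 B2 + Const A3 * B3 + trace_inner A4 B4
           + Const A5 * B5 + Const A6 * B6 + Const A7 * B7"

definition octic_cone :: "('n::finite) mpoly set" where
  "octic_cone = {octic_combination A1 A2 A4 A3 A5 A6 A7 | A1 A2 A4 A3 A5 A6 A7.
     psd A1 \<and> psd A2 \<and> psd A4 \<and> A3 \<ge> 0 \<and> A5 \<ge> 0 \<and> A6 \<ge> 0 \<and> A7 \<ge> 0}"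

text \<open>Coefficientwise form of the right side, with \<open>B3\<close>, \<open>B6\<close> and
  \<open>B7\<close> already evaluated to \<gamma>, \<alpha> and \<beta> up to the factor
  \<open>K\<close>. Membership in the cone is then checked one monomial at a time.\<close>

lemma lookup_octic_combination:
  fixes m :: "('n::finite) \<Rightarrow>\<^sub>0 nat"
  assumes S: "quad_coeff m = pattern \<alpha> \<beta> \<gamma> \<epsilon> \<zeta>"
  defines "N \<equiv> real CARD('n)"
  defines "K \<equiv> (N - 1) * (N - 2) * (N - 3) / N^3"
  shows "Poly_Mapping.lookup (octic_combination A1 A2 A4 A3 A5 A6 A7) m =
    A1$1$1 * mean44 (quad_coeff m) + (A1$1$2 + A1$2$1) * mean422 (quad_coeff m)
      + A1$2$2 * mean2222 (quad_coeff m)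
    + A2$1$1 * (mean422 (quad_coeff m) - mean2222 (quad_coeff m))
      + (A2$1$2 + A2$2$1) * (mean62 (quad_coeff m) - mean422 (quad_coeff m))
      + A2$2$2 * (mean8 (quad_coeff m) - mean44 (quad_coeff m))
    + A3 * (K * \<gamma>)
    + A4$1$1 * (mean2222 (quad_coeff m) - 1 / N * mean422 (quad_coeff m))
      + (A4$1$2 + A4$2$1) * (2 * mean422 (quad_coeff m) - 2 / N * mean62 (quad_coeff m))
      + A4$2$2 * (2 * mean62 (quad_coeff m) + 2 * mean44 (quad_coeff m) - 4 / N * mean8 (quad_coeff m))
    + A5 * (mean62 (quad_coeff m) - mean44 (quad_coeff m)) + A6 * (K * \<alpha>) + A7 * (K * \<beta>)"
proof -
  have B: "Poly_Mapping.lookup (B3 :: 'n mpoly) m = K * \<gamma>"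
    "Poly_Mapping.lookup (B6 :: 'n mpoly) m = K * \<alpha>"
    "Poly_Mapping.lookup (B7 :: 'n mpoly) m = K * \<beta>"
    by (simp_all only: B3_def B6_def B7_def Let_def lookup_add lookup_minus lookup_Const_mult
        lookup_two_mult lookup_p S mean_pattern_combinations K_def N_def)
  show ?thesis
    by (simp only: octic_combination_def B1_def B2_def B4_def B5_def Let_def trace_inner_mat2
        lookup_add lookup_minus lookup_Const_mult lookup_two_mult lookup_p B N_def)
      (simp only: distrib_right add_ac)
qed

lemma octic_combination_in_octic_cone:
  assumes "psd A1" "psd A2" "psd A4" "A3 \<ge> 0" "A5 \<ge> 0" "A6 \<ge> 0" "A7 \<ge> 0"
  shows "octic_combination A1 A2 A4 A3 A5 A6 A7 \<in> octic_cone"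
  using assms unfolding octic_cone_def by blast

lemma octic_cone_0: "0 \<in> octic_cone"
proof -
  have "octic_combination 0 0 0 0 0 0 0 \<in> octic_cone"
    by (rule octic_combination_in_octic_cone) simp_all
  then show ?thesis
    by (simp add: octic_combination_def B1_def B2_def B4_def Let_def trace_inner_mat2)
qed

lemma octic_cone_add:
  assumes "f \<in> octic_cone" "g \<in> octic_cone"
  shows "f + g \<in> octic_cone"
proof -
  from assms(1) obtain A1 A2 A4 A3 A5 A6 A7 where f: "f = octic_combination A1 A2 A4 A3 A5 A6 A7"
    "psd A1 \<and> psd A2 \<and> psd A4 \<and> A3 \<ge> 0 \<and> A5 \<ge> 0 \<and> A6 \<ge> 0 \<and> A7 \<ge> 0"
    unfolding octic_cone_def by blast
  from assms(2) obtain C1 C2 C4 C3 C5 C6 C7 where g: "g = octic_combination C1 C2 C4 C3 C5 C6 C7"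
    "psd C1 \<and> psd C2 \<and> psd C4 \<and> C3 \<ge> 0 \<and> C5 \<ge> 0 \<and> C6 \<ge> 0 \<and> C7 \<ge> 0"
    unfolding octic_cone_def by blast
  have "f + g = octic_combination (A1 + C1) (A2 + C2) (A4 + C4) (A3 + C3) (A5 + C5) (A6 + C6) (A7 + C7)"
    by (simp add: f g octic_combination_def B1_def B2_def B4_def Let_def trace_inner_mat2 Const_add
        distrib_right)
  also have "\<dots> \<in> octic_cone"
    using f(2) g(2) by (intro octic_combination_in_octic_cone psd_add add_nonneg_nonneg) simp_all
  finally show ?thesis .
qed

lemma octic_cone_sum: "(\<And>a. a \<in> A \<Longrightarrow> h a \<in> octic_cone) \<Longrightarrow> sum h A \<in> octic_cone"
  by (induction A rule: infinite_finite_induct) (auto intro: octic_cone_0 octic_cone_add)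

section \<open>Averaged squares of the three kinds of quartics lie in the cone\<close>

lemma power2_double_sum:
  fixes h :: "'a \<Rightarrow> 'b \<Rightarrow> 'c::comm_semiring_1"
  shows "(\<Sum>i\<in>A. \<Sum>j\<in>B. h i j) ^ 2 = (\<Sum>i\<in>A. \<Sum>j\<in>B. \<Sum>k\<in>A. \<Sum>l\<in>B. h i j * h k l)"
  unfolding power2_eq_square sum_distrib_right unfolding sum_distrib_left ..

lemma reynolds_even_part_in_octic_cone:
  fixes u :: "'n::finite \<Rightarrow> 'n \<Rightarrow> real"
  assumes card: "CARD('n) \<ge> 4" and sym: "\<And>i j. u i j = u j i"
  shows "reynolds ((\<Sum>i\<in>UNIV. \<Sum>j\<in>UNIV. Const (u i j) * (X i ^ 2 * X j ^ 2)) ^ 2) \<in> octic_cone"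
    (is "reynolds (?g ^ 2) \<in> _")
proof -
  let ?N = "real CARD('n)"
  obtain K where K: "K = (?N - 1) * (?N - 2) * (?N - 3) / ?N^3"
    by blast
  have k: "K > 0"
    unfolding K using card by (intro divide_pos_pos mult_pos_pos) auto
  obtain s w a b c e where psd: "\<forall>x y. 0 \<le> a * x^2 + 2 * b * x * y + c * y^2" and e: "0 \<le> e"
    and decomp: "\<And>\<alpha> \<beta> \<gamma> \<epsilon> \<zeta> S. S = pattern \<alpha> \<beta> \<gamma> \<epsilon> \<zeta> \<Longrightarrow>
      (\<Sum>i\<in>UNIV. \<Sum>j\<in>UNIV. \<Sum>k\<in>UNIV. \<Sum>l\<in>UNIV. u i j * u k l * S i j k l)
      = s^2 * mean44 S + 2 * s * w * mean422 S + w^2 * mean2222 S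
        + a * (mean422 S - mean2222 S) + 2 * b * (mean62 S - mean422 S) + c * (mean8 S - mean44 S)
        + e * \<gamma>"
  proof -
    from even_part_decomposition [where u = u, OF assms] obtain s w a b c e
      where psd: "\<forall>x y. 0 \<le> a * x^2 + 2 * b * x * y + c * y^2" and e: "0 \<le> e"
      and *: "\<forall>\<alpha> \<beta> \<gamma> \<epsilon> \<zeta>. let S = pattern \<alpha> \<beta> \<gamma> \<epsilon> \<zeta> in
      (\<Sum>i\<in>UNIV. \<Sum>j\<in>UNIV. \<Sum>k\<in>UNIV. \<Sum>l\<in>UNIV. u i j * u k l * S i j k l)
      = s^2 * mean44 S + 2 * s * w * mean422 S + w^2 * mean2222 S
        + a * (mean422 S - mean2222 S) + 2 * b * (mean62 S - mean422 S) + c * (mean8 S - mean44 S)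
        + e * \<gamma>"
      by blast
    show thesis
      using * [unfolded Let_def] by (intro that [OF psd e]) blast
  qed
  have "(Const (u i j) * (X i ^ 2 * X j ^ 2)) * (Const (u k l) * (X k ^ 2 * X l ^ 2))
      = Const (u i j * u k l) * (X i ^ 2 * X j ^ 2 * X k ^ 2 * X l ^ 2)" for i j k l
    by (simp only: Const_mult mult_ac)
  then have square: "?g ^ 2 = (\<Sum>i\<in>UNIV. \<Sum>j\<in>UNIV. \<Sum>k\<in>UNIV. \<Sum>l\<in>UNIV.
      Const (u i j * u k l) * (X i ^ 2 * X j ^ 2 * X k ^ 2 * X l ^ 2))"
    by (simp only: power2_double_sum)
  have sum: "Poly_Mapping.lookup (reynolds (?g ^ 2)) m
      = (\<Sum>i\<in>UNIV. \<Sum>j\<in>UNIV. \<Sum>k\<in>UNIV. \<Sum>l\<in>UNIV. u i j * u k l * quad_coeff m i j k l)" for m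
    by (simp only: square reynolds_sum reynolds_Const_mult lookup_sum lookup_Const_mult
        quad_coeff_def quad_def)
  \<comment> \<open>\<open>B1\<close> receives the rank-one matrix of \<open>(s, w)\<close> and
    \<open>B2\<close> the Gram matrix. The coefficient of \<open>B3\<close> is \<open>e / K\<close>,
    since \<open>B3\<close> contributes \<open>K * \<gamma>\<close> where
    \<open>e * \<gamma>\<close> is wanted.\<close>
  have "reynolds (?g ^ 2)
      = octic_combination (mat2 (s^2) (s * w) (s * w) (w^2)) (mat2 a b b c) 0 (e / K) 0 0 0"
  proof (rule poly_mapping_eqI)
    fix m :: "'n \<Rightarrow>\<^sub>0 nat"
    obtain \<alpha> \<beta> \<gamma> \<epsilon> \<zeta> where S: "quad_coeff m = pattern \<alpha> \<beta> \<gamma> \<epsilon> \<zeta>"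
      by (rule quad_coeff_obtain_pattern [OF card])
    show "Poly_Mapping.lookup (reynolds (?g ^ 2)) m = Poly_Mapping.lookup
        (octic_combination (mat2 (s^2) (s * w) (s * w) (w^2)) (mat2 a b b c) 0 (e / K) 0 0 0) m"
      unfolding sum decomp [OF S] lookup_octic_combination [OF S] K [symmetric] using k
      by (simp add: mat2_def vector_2)
  qed
  also have "\<dots> \<in> octic_cone"
  proof (rule octic_combination_in_octic_cone)
    have "s^2 * x^2 + 2 * (s * w) * x * y + w^2 * y^2 = (s * x + w * y)^2" for x y
      by (simp add: power2_eq_square algebra_simps)
    then show "psd (mat2 (s^2) (s * w) (s * w) (w^2))"
      unfolding psd_mat2 by (metis zero_le_power2)
    show "psd (mat2 a b b c)"
      unfolding psd_mat2 by (rule psd)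
    show "0 \<le> e / K"
      using e k by (rule divide_nonneg_pos)
  qed simp_all
  finally show ?thesis .
qed

text \<open>Serves both directions: it places such averages in the cone, and it later exhibits
  \<open>B4\<close> as one of them.\<close>

lemma lookup_reynolds_pair_part:
  fixes v :: "'n::finite \<Rightarrow> real"
  shows "Poly_Mapping.lookup (reynolds ((X a * X b * (\<Sum>k\<in>UNIV. Const (v k) * X k ^ 2)) ^ 2)) m
    = (\<Sum>k\<in>UNIV. \<Sum>l\<in>UNIV. v k * v l * quad_coeff m a b k l)"
proof -
  have "(Const (v k) * X k ^ 2) * (Const (v l) * X l ^ 2) = Const (v k * v l) * (X k ^ 2 * X l ^ 2)" for k l
    by (simp only: Const_mult mult_ac)
  then have "(X a * X b * (\<Sum>k\<in>UNIV. Const (v k) * X k ^ 2)) ^ 2 = X a ^ 2 * X b ^ 2 * (\<Sum>k\<in>UNIV. \<Sum>l\<in>UNIV. Const (v k * v l) * (X k ^ 2 * X l ^ 2))"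
    by (simp only: power_mult_distrib power2_eq_square [of "sum _ _"] sum_product)
  also have "\<dots> = (\<Sum>k\<in>UNIV. \<Sum>l\<in>UNIV. Const (v k * v l) * (X a ^ 2 * X b ^ 2 * X k ^ 2 * X l ^ 2))"
    by (simp only: sum_distrib_left mult_ac)
  finally show ?thesis
    by (simp only: reynolds_sum reynolds_Const_mult lookup_sum lookup_Const_mult quad_coeff_def quad_def)
qed

lemma reynolds_pair_part_in_octic_cone:
  fixes v :: "'n::finite \<Rightarrow> real"
  assumes card: "CARD('n) \<ge> 4" and ab: "a \<noteq> b"
  shows "reynolds ((X a * X b * (\<Sum>k\<in>UNIV. Const (v k) * X k ^ 2)) ^ 2) \<in> octic_cone"
    (is "reynolds (?g ^ 2) \<in> _")
proof -
  let ?N = "real CARD('n)"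
  obtain K where K: "K = (?N - 1) * (?N - 2) * (?N - 3) / ?N^3"
    by blast
  have k: "K > 0"
    unfolding K using card by (intro divide_pos_pos mult_pos_pos) auto
  obtain C where C: "C = ?N / (?N - 1)"
    by blast
  then have "C \<ge> 0"
    using card by simp
  have C2: "2 * ?N / (?N - 1) = 2 * C"
    by (simp add: C)
  obtain g where g: "g = ((\<Sum>k\<in>UNIV. v k) - v a - v b) / (?N - 2)"
    by blast
  obtain s where s: "s = (v a + v b) / 2 - g"
    by blast
  obtain t where t: "t = (v a - v b) / 2"
    by blast
  obtain e where e: "e = (\<Sum>k\<in>- {a, b}. (v k - g)^2)"
    by blast
  \<comment> \<open>\<open>B4\<close> receives \<open>C\<close> times the rank-one matrix of
    \<open>(N * g, s)\<close>, \<open>B5\<close> the antisymmetric part, and \<open>B7\<close> the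
    variance \<open>e\<close>, divided by \<open>K\<close> because \<open>B7\<close> contributes
    \<open>K * \<beta>\<close>.\<close>
  have "reynolds (?g ^ 2) = octic_combination 0 0
      (mat2 (C * (?N * g)^2) (C * (?N * g * s)) (C * (?N * g * s)) (C * s^2))
      0 (2 * C * t^2) 0 (e / K)"
  proof (rule poly_mapping_eqI)
    fix m :: "'n \<Rightarrow>\<^sub>0 nat"
    obtain \<alpha> \<beta> \<gamma> \<epsilon> \<zeta> where S: "quad_coeff m = pattern \<alpha> \<beta> \<gamma> \<epsilon> \<zeta>"
      by (rule quad_coeff_obtain_pattern [OF card])
    show "Poly_Mapping.lookup (reynolds (?g ^ 2)) m = Poly_Mapping.lookup
        (octic_combination 0 0 (mat2 (C * (?N * g)^2) (C * (?N * g * s)) (C * (?N * g * s)) (C * s^2))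
          0 (2 * C * t^2) 0 (e / K)) m"
      unfolding lookup_reynolds_pair_part pair_part_decomposition [OF card ab S, of v] lookup_octic_combination [OF S] K [symmetric]
        g [symmetric] s [symmetric] t [symmetric] e [symmetric] C2 C [symmetric]
      using k by (simp add: mat2_def vector_2 algebra_simps)
  qed
  also have "\<dots> \<in> octic_cone"
  proof (rule octic_combination_in_octic_cone)
    have "C * (?N * g)^2 * x^2 + 2 * (C * (?N * g * s)) * x * y + C * s^2 * y^2
        = C * (?N * g * x + s * y)^2" for x y
      by (simp add: power2_eq_square algebra_simps)
    moreover have "0 \<le> C * (?N * g * x + s * y)^2" for x y
      using \<open>C \<ge> 0\<close> by simp
    ultimately show "psd (mat2 (C * (?N * g)^2) (C * (?N * g * s)) (C * (?N * g * s)) (C * s^2))"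
      unfolding psd_mat2 by presburger
    show "0 \<le> e / K"
      using k by (intro divide_nonneg_pos) (simp_all add: e sum_nonneg)
    show "0 \<le> 2 * C * t^2"
      using \<open>C \<ge> 0\<close> by simp
  qed simp_all
  finally show ?thesis .
qed

text \<open>The coefficients are \<open>r^2\<close> times the value of \<open>quad_coeff m\<close>
  at four distinct indices, which is \<alpha>, and \<open>B6\<close> is \<open>K\<close> times
  \<alpha>. This is why the pattern is taken with its first coefficient explicit.\<close>

lemma reynolds_squarefree_part_in_octic_cone:
  fixes a b c d :: "'n::finite"
  assumes dist: "distinct [a, b, c, d]"
  shows "reynolds ((Const r * (X a * X b * X c * X d)) ^ 2) \<in> octic_cone"
    (is "reynolds (?g ^ 2) \<in> _")
proof -
  let ?N = "real CARD('n)"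
  obtain K where K: "K = (?N - 1) * (?N - 2) * (?N - 3) / ?N^3"
    by blast
  have "card {a, b, c, d} \<le> CARD('n)"
    by (rule card_mono) simp_all
  then have card: "CARD('n) \<ge> 4"
    using dist by simp
  have k: "K > 0"
    unfolding K using card by (intro divide_pos_pos mult_pos_pos) auto
  have "?g ^ 2 = Const (r^2) * (X a ^ 2 * X b ^ 2 * X c ^ 2 * X d ^ 2)"
    by (simp only: power_mult_distrib Const_power)
  then have lookup: "Poly_Mapping.lookup (reynolds (?g ^ 2)) m = r^2 * quad_coeff m a b c d" for m
    by (simp only: reynolds_Const_mult lookup_Const_mult quad_coeff_def quad_def)
  have "reynolds (?g ^ 2) = octic_combination 0 0 0 0 0 (r^2 / K) 0"
  proof (rule poly_mapping_eqI)
    fix m :: "'n \<Rightarrow>\<^sub>0 nat"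
    obtain \<epsilon> \<zeta> where S: "quad_coeff m = pattern (quad_coeff m a b c d)
      (quad_coeff m a a b c - quad_coeff m a b c d)
      (quad_coeff m a a b b - 2 * quad_coeff m a a b c + quad_coeff m a b c d) \<epsilon> \<zeta>"
      using quad_coeff_pattern [OF dist] by blast
    show "Poly_Mapping.lookup (reynolds (?g ^ 2)) m
        = Poly_Mapping.lookup (octic_combination 0 0 0 0 0 (r^2 / K) 0) m"
      unfolding lookup lookup_octic_combination [OF S] K [symmetric] using k by simp
  qed
  also have "\<dots> \<in> octic_cone"
    using k by (intro octic_combination_in_octic_cone divide_nonneg_pos) simp_all
  finally show ?thesis .
qed

section \<open>Splitting a quartic form by parity\<close>

text \<open>The component of \<open>g\<close> in the grading by sets of variables with odd exponent,
  that is, by characters of the group of sign changes.\<close>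

definition parity_part :: "'n set \<Rightarrow> ('n::finite) mpoly \<Rightarrow> 'n mpoly" where
  "parity_part T g = (\<Sum>m | m \<in> Poly_Mapping.keys g \<and> {i. odd (Poly_Mapping.lookup m i)} = T.
     Const (Poly_Mapping.lookup g m) * monom_at X m)"

lemma sum_parity_parts: "(\<Sum>T\<in>UNIV. parity_part T g) = g"
proof -
  have "(\<Sum>T\<in>UNIV. parity_part T g)
      = (\<Sum>m\<in>Poly_Mapping.keys g. Const (Poly_Mapping.lookup g m) * monom_at X m)"
    unfolding parity_part_def by (rule sum.group) simp_all
  then show ?thesis
    by (simp only: mpoly_eq_sum_monoms [symmetric])
qed

definition flip :: "'n \<Rightarrow> ('n::finite \<Rightarrow> 'n) \<times> ('n \<Rightarrow> real)" where
  "flip i = (id, \<lambda>j. if j = i then -1 else 1)"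

lemma flip_in_signed_perms: "flip i \<in> signed_perms"
  by (simp add: flip_def signed_perms_def)

lemma act_flip_monom:
  "act (flip i) (monom_at X m) = Const ((-1) ^ Poly_Mapping.lookup m i) * monom_at X m"
proof -
  have "act (flip i) (X j ^ Poly_Mapping.lookup m j)
      = (if j = i then Const ((-1) ^ Poly_Mapping.lookup m i) else 1) * X j ^ Poly_Mapping.lookup m j" for j
    by (simp add: act_simps flip_def power_mult_distrib Const_power)
  then show ?thesis
    by (simp add: monom_at_def act_simps(8) prod.distrib)
qed

lemma act_flip_parity_part:
  "act (flip i) (parity_part T g) = (if i \<in> T then - parity_part T g else parity_part T g)"
proof -
  have "act (flip i) (parity_part T g) = Const (if i \<in> T then -1 else 1) * parity_part T g"
    unfolding parity_part_def act_simps(7) sum_distrib_left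
  proof (rule sum.cong [OF refl])
    fix m
    assume "m \<in> {m \<in> Poly_Mapping.keys g. {i. odd (Poly_Mapping.lookup m i)} = T}"
    then have "(-1 :: real) ^ Poly_Mapping.lookup m i = (if i \<in> T then -1 else 1)"
      by auto
    then show "act (flip i) (Const (Poly_Mapping.lookup g m) * monom_at X m)
      = Const (if i \<in> T then -1 else 1) * (Const (Poly_Mapping.lookup g m) * monom_at X m)"
      by (simp only: act_simps(4,6) act_flip_monom mult_ac)
  qed
  then show ?thesis
    by (simp add: Const_uminus)
qed

text \<open>Flipping the sign of a variable in exactly one of the two sets negates the
  product.\<close>

lemma reynolds_parity_parts_orthogonal:
  assumes "T \<noteq> T'"
  shows "reynolds (parity_part T g * parity_part T' g) = 0"
proof -
  obtain i where "i \<in> T \<longleftrightarrow> i \<notin> T'"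
    using assms by blast
  then have "act (flip i) (parity_part T g * parity_part T' g) = - (parity_part T g * parity_part T' g)"
    by (auto simp: act_simps(4) act_flip_parity_part)
  then show ?thesis
    using flip_in_signed_perms reynolds_eq_0 by blast
qed

lemma reynolds_square_parity_parts:
  "reynolds (g ^ 2) = (\<Sum>T\<in>UNIV. reynolds (parity_part T g ^ 2))"
proof -
  have "reynolds (g ^ 2) = reynolds ((\<Sum>T\<in>UNIV. parity_part T g) * (\<Sum>T\<in>UNIV. parity_part T g))"
    by (simp only: sum_parity_parts power2_eq_square)
  also have "\<dots> = (\<Sum>T\<in>UNIV. \<Sum>T'\<in>UNIV. reynolds (parity_part T g * parity_part T' g))"
    by (simp only: sum_product reynolds_sum)
  also have "\<dots> = (\<Sum>T\<in>UNIV. \<Sum>T'\<in>UNIV. if T' = T then reynolds (parity_part T g ^ 2) else 0)"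
    by (intro sum.cong refl) (simp add: reynolds_parity_parts_orthogonal power2_eq_square)
  finally show ?thesis
    by simp
qed

text \<open>Peels one factor off a monomial. Repeated use writes a monomial of known small degree as
  an explicit product.\<close>

lemma prod_power_Suc_degree:
  fixes y :: "'i::finite \<Rightarrow> 'a::comm_monoid_mult"
  assumes "(\<Sum>i\<in>UNIV. h i) = Suc k"
  obtains i h' where "(\<Sum>i\<in>UNIV. h' i) = k" "(\<Prod>i\<in>UNIV. y i ^ h i) = y i * (\<Prod>i\<in>UNIV. y i ^ h' i)"
proof -
  obtain i where i: "h i > 0"
    using assms by (metis finite gr0I nat.distinct(1) sum.neutral)
  define h' where "h' = h(i := h i - 1)"
  have rest: "(\<Sum>j\<in>UNIV - {i}. h' j) = (\<Sum>j\<in>UNIV - {i}. h j)"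
    "(\<Prod>j\<in>UNIV - {i}. y j ^ h' j) = (\<Prod>j\<in>UNIV - {i}. y j ^ h j)"
    by (auto simp: h'_def intro!: sum.cong prod.cong)
  have "(\<Sum>j\<in>UNIV. h' j) = k"
    using assms i by (simp add: sum.remove [of UNIV i] rest) (simp add: h'_def)
  moreover have "(\<Prod>j\<in>UNIV. y j ^ h j) = y i * (\<Prod>j\<in>UNIV. y j ^ h' j)"
    using i by (simp add: prod.remove [of UNIV i] rest)
      (simp add: h'_def mult.assoc [symmetric] power_Suc [symmetric] del: power_Suc)
  ultimately show thesis
    by (rule that)
qed

text \<open>Every exponent is its parity plus twice its half. In degree 4 the second equation leaves
  only 0, 2 or 4 odd exponents.\<close>

lemma monom_parity:
  fixes m :: "('n::finite) \<Rightarrow>\<^sub>0 nat"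
  defines "T \<equiv> {i. odd (Poly_Mapping.lookup m i)}"
    and "h \<equiv> \<lambda>i. Poly_Mapping.lookup m i div 2"
  shows "monom_at X m = (\<Prod>i\<in>T. X i) * (\<Prod>i\<in>UNIV. (X i ^ 2) ^ h i)"
    and "mdeg m = card T + 2 * (\<Sum>i\<in>UNIV. h i)"
proof -
  have split: "Poly_Mapping.lookup m i = (if i \<in> T then 1 else 0) + 2 * h i" for i
    by (simp add: T_def h_def)
  have "X i ^ Poly_Mapping.lookup m i = (if i \<in> T then X i else 1) * (X i ^ 2) ^ h i" for i
    by (subst split) (simp add: power_add power_mult)
  then show "monom_at X m = (\<Prod>i\<in>T. X i) * (\<Prod>i\<in>UNIV. (X i ^ 2) ^ h i)"
    by (simp add: monom_at_def prod.distrib prod.If_cases)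
  show "mdeg m = card T + 2 * (\<Sum>i\<in>UNIV. h i)"
    by (simp only: mdeg_def split) (simp add: sum.distrib sum_distrib_left sum.If_cases)
qed

lemma sum_closed:
  assumes "0 \<in> E" "\<And>f g. f \<in> E \<Longrightarrow> g \<in> E \<Longrightarrow> f + g \<in> E" "\<And>a. a \<in> A \<Longrightarrow> h a \<in> E"
  shows "sum h A \<in> E"
  using assms(3) by (induction A rule: infinite_finite_induct) (auto intro: assms(1,2))

text \<open>Polynomials given by symmetric arrays are closed under addition, so it suffices to
  represent one monomial; \<open>even_part_decomposition\<close> requires the symmetry.\<close>

lemma sum_even_quartics:
  fixes h :: "'b \<Rightarrow> ('n::finite) mpoly"
  assumes "\<And>m. m \<in> M \<Longrightarrow> \<exists>c a b. h m = Const c * (X a ^ 2 * X b ^ 2)"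
  shows "\<exists>u. (\<forall>i j. u i j = u j i) \<and> sum h M = (\<Sum>i\<in>UNIV. \<Sum>j\<in>UNIV. Const (u i j) * (X i ^ 2 * X j ^ 2))"
proof -
  define S where "S u = (\<Sum>i\<in>UNIV. \<Sum>j\<in>UNIV. Const (u i j) * (X i ^ 2 * X j ^ 2) :: 'n mpoly)" for u
  define E where "E = {S u | u. \<forall>i j. u i j = u j i}"
  have E: "S u \<in> E" if "\<And>i j. u i j = u j i" for u
    using that unfolding E_def by blast
  have "sum h M \<in> E"
  proof (rule sum_closed)
    have "S (\<lambda>_ _. 0) = 0"
      by (simp add: S_def)
    then show "0 \<in> E"
      using E [of "\<lambda>_ _. 0"] by simp
  next
    fix f g assume "f \<in> E" "g \<in> E"
    then obtain u v where uv: "f = S u" "g = S v" "\<forall>i j. u i j = u j i" "\<forall>i j. v i j = v j i"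
      unfolding E_def by blast
    have "f + g = S (\<lambda>i j. u i j + v i j)"
      unfolding uv S_def by (simp add: Const_add distrib_right sum.distrib)
    then show "f + g \<in> E"
      using uv E [of "\<lambda>i j. u i j + v i j"] by metis
  next
    fix m assume "m \<in> M"
    then obtain c a b where h: "h m = Const c * (X a ^ 2 * X b ^ 2)"
      using assms by blast
    \<comment> \<open>The coefficient is split evenly between (a,b) and (b,a). For
      \<open>a = b\<close> both halves fall on the same entry and add up to
      \<open>c\<close>.\<close>
    define u :: "'n \<Rightarrow> 'n \<Rightarrow> real" where
      "u i j = (if i = a then if j = b then c / 2 else 0 else 0)
        + (if i = b then if j = a then c / 2 else 0 else 0)" for i j
    have single: "(\<Sum>i\<in>UNIV. \<Sum>j\<in>UNIV. Const (if i = a then if j = b then r else 0 else 0) * (X i ^ 2 * X j ^ 2))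
        = Const r * (X a ^ 2 * X b ^ 2)" for a b :: 'n and r
    proof -
      have "(\<Sum>j\<in>UNIV. Const (if i = a then if j = b then r else 0 else 0) * (X i ^ 2 * X j ^ 2))
          = (\<Sum>j\<in>UNIV. if j = b then if i = a then Const r * (X i ^ 2 * X j ^ 2) else 0 else 0)" for i
        by (rule sum.cong) auto
      then show ?thesis
        by simp
    qed
    have "S u = Const (c / 2) * (X a ^ 2 * X b ^ 2) + Const (c / 2) * (X b ^ 2 * X a ^ 2)"
      by (simp only: S_def u_def Const_add distrib_right sum.distrib single)
    also have "\<dots> = Const (c / 2 + c / 2) * (X a ^ 2 * X b ^ 2)"
      by (simp only: Const_add distrib_right mult.commute [of "X b ^ 2"])
    finally have "h m = S u"
      by (simp add: h)
    moreover have "u i j = u j i" for i j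
      by (simp add: u_def)
    ultimately show "h m \<in> E"
      using E by metis
  qed
  then show ?thesis
    unfolding E_def S_def by blast
qed

lemma sum_pair_quartics:
  fixes h :: "'b \<Rightarrow> ('n::finite) mpoly"
  assumes "\<And>m. m \<in> M \<Longrightarrow> \<exists>c k. h m = q * (Const c * X k ^ 2)"
  shows "\<exists>v. sum h M = q * (\<Sum>k\<in>UNIV. Const (v k) * X k ^ 2)"
proof -
  define S where "S v = q * (\<Sum>k\<in>UNIV. Const (v k) * X k ^ 2)" for v
  have "sum h M \<in> range S"
  proof (rule sum_closed)
    have "S (\<lambda>_. 0) = 0"
      by (simp add: S_def)
    then show "0 \<in> range S"
      by (metis rangeI)
  next
    fix f g assume "f \<in> range S" "g \<in> range S"
    then obtain u v where uv: "f = S u" "g = S v"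
      by blast
    have "f + g = S (\<lambda>k. u k + v k)"
      unfolding uv S_def by (simp add: Const_add distrib_right distrib_left sum.distrib)
    then show "f + g \<in> range S"
      by blast
  next
    fix m assume "m \<in> M"
    then obtain c k where h: "h m = q * (Const c * X k ^ 2)"
      using assms by blast
    have "(\<Sum>j\<in>UNIV. Const (if j = k then c else 0) * X j ^ 2) = (\<Sum>j\<in>UNIV. if j = k then Const c * X j ^ 2 else 0)"
      by (rule sum.cong) auto
    then have "h m = S (\<lambda>j. if j = k then c else 0)"
      by (simp add: h S_def)
    then show "h m \<in> range S"
      by blast
  qed
  then show ?thesis
    unfolding S_def by blast
qed

text \<open>The size of \<open>T\<close> selects one of the three kinds of quartics: even, two odd
  variables times a diagonal quadratic form, or squarefree.\<close>

lemma reynolds_parity_part_in_octic_cone: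
  fixes g :: "('n::finite) mpoly"
  assumes card: "CARD('n) \<ge> 4" and hom: "homogeneous 4 g"
  shows "reynolds (parity_part T g ^ 2) \<in> octic_cone"
proof -
  define M where "M = {m \<in> Poly_Mapping.keys g. {i. odd (Poly_Mapping.lookup m i)} = T}"
  define h where "h m i = Poly_Mapping.lookup m i div 2" for m :: "'n \<Rightarrow>\<^sub>0 nat" and i
  have part: "parity_part T g = (\<Sum>m\<in>M. Const (Poly_Mapping.lookup g m) * monom_at X m)"
    by (simp add: parity_part_def M_def)
  have degree: "card T + 2 * (\<Sum>i\<in>UNIV. h m i) = 4"
    and monom: "monom_at X m = (\<Prod>i\<in>T. X i) * (\<Prod>i\<in>UNIV. (X i ^ 2) ^ h m i)" if "m \<in> M" for m
    using that hom monom_parity [of m] by (auto simp: M_def h_def homogeneous_iff)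
  show ?thesis
  proof (cases "M = {}")
    \<comment> \<open>Without a monomial nothing restricts the size of \<open>T\<close>, but the
      part is zero.\<close>
    case True
    then show ?thesis
      by (simp add: part octic_cone_0)
  next
    case False
    then obtain m where "m \<in> M"
      by blast
    then have "card T + 2 * (\<Sum>i\<in>UNIV. h m i) = 4"
      by (rule degree)
    then have "card T = 0 \<or> card T = 2 \<or> card T = 4"
      by presburger
    then consider "card T = 0" | "card T = 2" | "card T = 4"
      by argo
    then show ?thesis
    proof cases
      case 1
      then have "T = {}"
        by simp
      have "\<exists>c a b. Const (Poly_Mapping.lookup g m) * monom_at X m = Const c * (X a ^ 2 * X b ^ 2)"
        if m: "m \<in> M" for m
      proof -
        have "(\<Sum>i\<in>UNIV. h m i) = Suc (Suc 0)"
          using degree [OF m] 1 by simp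
        from prod_power_Suc_degree [OF this, of "\<lambda>i. X i ^ 2"] obtain a h' where
          a: "(\<Sum>i\<in>UNIV. h' i) = Suc 0"
            "(\<Prod>i\<in>UNIV. (X i ^ 2) ^ h m i) = X a ^ 2 * (\<Prod>i\<in>UNIV. (X i ^ 2) ^ h' i)" .
        from prod_power_Suc_degree [OF a(1), of "\<lambda>i. X i ^ 2"] obtain b h'' where
          b: "(\<Sum>i\<in>UNIV. h'' i) = 0"
            "(\<Prod>i\<in>UNIV. (X i ^ 2) ^ h' i) = X b ^ 2 * (\<Prod>i\<in>UNIV. (X i ^ 2) ^ h'' i)" .
        have "(\<Prod>i\<in>UNIV. (X i ^ 2) ^ h'' i) = 1"
          using b(1) by simp
        then have "Const (Poly_Mapping.lookup g m) * monom_at X m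
            = Const (Poly_Mapping.lookup g m) * (X a ^ 2 * X b ^ 2)"
          by (simp only: monom [OF m] a(2) b(2) \<open>T = {}\<close> prod.empty mult_1 mult_1_right)
        then show ?thesis
          by blast
      qed
      then have "\<exists>u. (\<forall>i j. u i j = u j i) \<and>
          parity_part T g = (\<Sum>i\<in>UNIV. \<Sum>j\<in>UNIV. Const (u i j) * (X i ^ 2 * X j ^ 2))"
        unfolding part by (rule sum_even_quartics)
      then obtain u where u: "\<forall>i j. u i j = u j i"
        "parity_part T g = (\<Sum>i\<in>UNIV. \<Sum>j\<in>UNIV. Const (u i j) * (X i ^ 2 * X j ^ 2))"
        by (elim exE conjE)
      show ?thesis
        unfolding u(2) by (rule reynolds_even_part_in_octic_cone [OF card]) (use u(1) in blast)
    next
      case 2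
      then obtain a b where T: "T = {a, b}" "a \<noteq> b"
        by (auto simp: card_2_iff)
      have "\<exists>c k. Const (Poly_Mapping.lookup g m) * monom_at X m = (X a * X b) * (Const c * X k ^ 2)"
        if m: "m \<in> M" for m
      proof -
        have "(\<Sum>i\<in>UNIV. h m i) = Suc 0"
          using degree [OF m] 2 by simp
        from prod_power_Suc_degree [OF this, of "\<lambda>i. X i ^ 2"] obtain k h' where
          k: "(\<Sum>i\<in>UNIV. h' i) = 0"
            "(\<Prod>i\<in>UNIV. (X i ^ 2) ^ h m i) = X k ^ 2 * (\<Prod>i\<in>UNIV. (X i ^ 2) ^ h' i)" .
        have "(\<Prod>i\<in>UNIV. (X i ^ 2) ^ h' i) = 1"
          using k(1) by simp
        then have "Const (Poly_Mapping.lookup g m) * monom_at X m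
            = (X a * X b) * (Const (Poly_Mapping.lookup g m) * X k ^ 2)"
          unfolding monom [OF m] k using T by (simp add: mult_ac)
        then show ?thesis
          by blast
      qed
      then have "\<exists>v. parity_part T g = X a * X b * (\<Sum>k\<in>UNIV. Const (v k) * X k ^ 2)"
        unfolding part by (rule sum_pair_quartics)
      then obtain v where v: "parity_part T g = X a * X b * (\<Sum>k\<in>UNIV. Const (v k) * X k ^ 2)"
        by (elim exE)
      show ?thesis
        unfolding v by (rule reynolds_pair_part_in_octic_cone [OF card T(2)])
    next
      case 3
      then obtain xs where "set xs = T" "distinct xs"
        using finite_distinct_list [of T] by auto
      then have "length xs = 4"
        using 3 distinct_card by force
      then obtain a b c d where "xs = [a, b, c, d]"
        by (auto simp: length_Suc_conv numeral_eq_Suc)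
      then have T: "T = {a, b, c, d}" and dist: "distinct [a, b, c, d]"
        using \<open>set xs = T\<close> \<open>distinct xs\<close> by auto
      have "Const (Poly_Mapping.lookup g m) * monom_at X m
          = Const (Poly_Mapping.lookup g m) * (X a * X b * X c * X d)" if m: "m \<in> M" for m
      proof -
        have "(\<Sum>i\<in>UNIV. h m i) = 0"
          using degree [OF m] 3 by simp
        then have "(\<Prod>i\<in>UNIV. (X i ^ 2) ^ h m i) = 1"
          by simp
        then show ?thesis
          unfolding monom [OF m] T using dist by (simp add: mult_ac)
      qed
      \<comment> \<open>All monomials in \<open>M\<close> equal the same product, so their
        coefficients are simply added.\<close>
      then have "parity_part T g = Const (\<Sum>m\<in>M. Poly_Mapping.lookup g m) * (X a * X b * X c * X d)"
        by (simp add: part Const_sum sum_distrib_right)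
      then show ?thesis
        using reynolds_squarefree_part_in_octic_cone [OF dist] by simp
    qed
  qed
qed

section \<open>From invariant sums of squares to the cone\<close>

lemma reynolds_square_in_octic_cone:
  fixes g :: "('n::finite) mpoly"
  assumes "CARD('n) \<ge> 4" "homogeneous 4 g"
  shows "reynolds (g ^ 2) \<in> octic_cone"
  by (subst reynolds_square_parity_parts)
    (intro octic_cone_sum reynolds_parity_part_in_octic_cone [OF assms])

text \<open>The definition admits forms of any degrees, but only squares of quartics reach degree 8;
  the others must cancel and may be dropped.\<close>

lemma sum_of_squares_quartics:
  fixes f :: "('n::finite) mpoly"
  assumes "homogeneous 8 f" "sum_of_squares f"
  obtains gs where "\<forall>g\<in>set gs. homogeneous 4 g" "f = (\<Sum>g\<leftarrow>gs. g ^ 2)"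
proof -
  obtain gs where gs: "\<forall>g\<in>set gs. form g" and f: "f = (\<Sum>g\<leftarrow>gs. g ^ 2)"
    using assms(2) unfolding sum_of_squares_def by blast
  define hs where "hs = filter (homogeneous 4) gs"
  have lookup_sum_list: "Poly_Mapping.lookup (\<Sum>g\<leftarrow>gs. h g) m = (\<Sum>g\<leftarrow>gs. Poly_Mapping.lookup (h g) m)"
    for gs :: "'n mpoly list" and h m
    by (induction gs) (simp_all add: lookup_add)
  have degree: "\<exists>d. homogeneous (2 * d) (g ^ 2) \<and> (d = 4 \<longrightarrow> homogeneous 4 g)" if "g \<in> set gs" for g
  proof -
    have "form g"
      using gs that by (rule bspec)
    then obtain d where "homogeneous d g"
      unfolding form_def by (elim exE)
    then show ?thesis
      using homogeneous_power [of d g 2] by (intro exI [of _ d]) auto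
  qed
  have other: "Poly_Mapping.lookup (g ^ 2) m = 0" if g: "g \<in> set gs" "\<not> homogeneous 4 g" and "mdeg m = 8" for g m
  proof -
    obtain d where "homogeneous (2 * d) (g ^ 2)" "d \<noteq> 4"
      using degree [OF g(1)] g(2) by auto
    then show ?thesis
      using that(3) by (intro homogeneous_lookup [of "2 * d"]) auto
  qed
  have quartic: "Poly_Mapping.lookup (g ^ 2) m = 0" if "g \<in> set hs" "mdeg m \<noteq> 8" for g m
    using that homogeneous_power [of 4 g 2] by (intro homogeneous_lookup [of 8]) (simp_all add: hs_def)
  \<comment> \<open>In degree 8 the discarded squares have zero coefficients; in every other degree
    both \<open>f\<close> and the kept squares have.\<close>
  have "f = (\<Sum>g\<leftarrow>hs. g ^ 2)"
  proof (rule poly_mapping_eqI)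
    fix m
    show "Poly_Mapping.lookup f m = Poly_Mapping.lookup (\<Sum>g\<leftarrow>hs. g ^ 2) m"
    proof (cases "mdeg m = 8")
      case True
      have "(\<Sum>g\<leftarrow>gs. Poly_Mapping.lookup (g ^ 2) m)
          = (\<Sum>g\<leftarrow>gs. Poly_Mapping.lookup (if homogeneous 4 g then g ^ 2 else 0) m)"
        by (intro arg_cong [where f = sum_list] map_cong refl) (simp add: other True)
      then show ?thesis
        by (simp only: f hs_def lookup_sum_list sum_list_map_filter')
    next
      case False
      have "(\<Sum>g\<leftarrow>hs. Poly_Mapping.lookup (g ^ 2) m) = (\<Sum>g\<leftarrow>hs. 0)"
        by (intro arg_cong [where f = sum_list] map_cong refl) (simp add: quartic False)
      then show ?thesis
        using homogeneous_lookup [OF assms(1) False] by (simp add: lookup_sum_list)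
    qed
  qed
  moreover have "\<forall>g\<in>set hs. homogeneous 4 g"
    by (simp add: hs_def)
  ultimately show thesis
    using that by blast
qed

lemma sum_of_squares_in_octic_cone:
  fixes f :: "('n::finite) mpoly"
  assumes card: "CARD('n) \<ge> 4" and f: "f \<in> even_symmetric_forms 8" "sum_of_squares f"
  shows "f \<in> octic_cone"
proof -
  have "homogeneous 8 f"
    using f(1) by (simp add: even_symmetric_forms_def)
  then obtain gs where gs: "\<forall>g\<in>set gs. homogeneous 4 g" "f = (\<Sum>g\<leftarrow>gs. g ^ 2)"
    using sum_of_squares_quartics f(2) by blast
  have "reynolds (\<Sum>g\<leftarrow>gs. g ^ 2) \<in> octic_cone"
    using gs(1) by (induction gs)
      (auto simp: reynolds_add intro: octic_cone_0 octic_cone_add reynolds_square_in_octic_cone [OF card])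
  then show ?thesis
    using reynolds_even_symmetric [OF f(1)] gs(2) by simp
qed

section \<open>The cone consists of sums of squares\<close>

lemma sum_of_squares_0: "sum_of_squares 0"
  unfolding sum_of_squares_def by (rule exI [of _ "[]"]) simp

lemma sum_of_squares_square: "homogeneous d g \<Longrightarrow> sum_of_squares (g ^ 2)"
  unfolding sum_of_squares_def form_def by (rule exI [of _ "[g]"]) auto

lemma sum_of_squares_add:
  assumes "sum_of_squares f" "sum_of_squares g"
  shows "sum_of_squares (f + g)"
proof -
  obtain fs gs where fs: "\<forall>h\<in>set fs. form h" "f = (\<Sum>h\<leftarrow>fs. h ^ 2)"
    and gs: "\<forall>h\<in>set gs. form h" "g = (\<Sum>h\<leftarrow>gs. h ^ 2)"
    using assms unfolding sum_of_squares_def by (elim exE conjE)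
  then have "(\<forall>h\<in>set (fs @ gs). form h) \<and> f + g = (\<Sum>h\<leftarrow>fs @ gs. h ^ 2)"
    by auto
  then show ?thesis
    unfolding sum_of_squares_def by (rule exI)
qed

lemma sum_of_squares_sum:
  "(\<And>a. a \<in> A \<Longrightarrow> sum_of_squares (h a)) \<Longrightarrow> sum_of_squares (sum h A)"
  by (induction A rule: infinite_finite_induct) (auto intro: sum_of_squares_0 sum_of_squares_add)

lemma sum_of_squares_Const_mult:
  assumes "0 \<le> c" "sum_of_squares f"
  shows "sum_of_squares (Const c * f)"
proof -
  obtain gs where gs: "\<forall>g\<in>set gs. form g" "f = (\<Sum>g\<leftarrow>gs. g ^ 2)"
    using assms(2) unfolding sum_of_squares_def by (elim exE conjE)
  let ?hs = "map (\<lambda>g. Const (sqrt c) * g) gs"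
  have "(Const (sqrt c) * g) ^ 2 = Const c * g ^ 2" for g :: "'a mpoly"
    using assms(1) by (simp add: power_mult_distrib Const_power [symmetric])
  then have "Const c * f = (\<Sum>g\<leftarrow>?hs. g ^ 2)"
    unfolding gs(2) by (simp add: o_def sum_list_const_mult)
  moreover have "\<forall>g\<in>set ?hs. form g"
    using gs(1) unfolding form_def by (auto intro: homogeneous_Const_mult)
  ultimately show ?thesis
    unfolding sum_of_squares_def by (intro exI conjI)
qed

text \<open>Every signed permutation carries squares of forms to squares of forms, and the average
  has nonnegative weights.\<close>

lemma sum_of_squares_reynolds_square:
  assumes "homogeneous d g"
  shows "sum_of_squares (reynolds (g ^ 2))"
  unfolding reynolds_def act_simps(5)
  by (intro sum_of_squares_Const_mult sum_of_squares_sum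
      sum_of_squares_square [OF homogeneous_act [OF assms]]) simp

lemma sum_of_squares_scaled_reynolds_square:
  "f = Const r * reynolds (g ^ 2) \<Longrightarrow> homogeneous d g \<Longrightarrow> 0 \<le> r \<Longrightarrow> sum_of_squares f"
  by (simp only: sum_of_squares_Const_mult sum_of_squares_reynolds_square)

section \<open>Squares realising each generator of the cone\<close>

lemma homogeneous_X_square: "homogeneous 2 (X i ^ 2)"
  using homogeneous_power [OF homogeneous_X, of 2 i] by simp

lemma homogeneous_power_mean: "homogeneous k (power_mean k)"
proof -
  have "homogeneous k (X i ^ k)" for i :: 'a
    using homogeneous_power [OF homogeneous_X, of k i] by simp
  then show ?thesis
    unfolding power_mean_def by (intro homogeneous_Const_mult homogeneous_sum)
qed

text \<open>By the Cholesky factorisation it is enough to treat the rank-one matrix of each vector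
  \<open>(x, y)\<close>.\<close>

lemma sum_of_squares_trace_inner:
  fixes A :: "real ^ 2 ^ 2"
  assumes "psd A"
    and "\<And>x y. sum_of_squares (Const (x^2) * P + Const (2 * (x * y)) * Q + Const (y^2) * R)"
  shows "sum_of_squares (trace_inner A (mat2 P Q Q R))"
proof -
  obtain x y x' y' where A: "A$1$1 = x^2 + x'^2" "A$1$2 = x * y + x' * y'"
    "A$2$1 = x * y + x' * y'" "A$2$2 = y^2 + y'^2"
    using assms(1) by (rule psd_eq_sum_rank_one)
  have "trace_inner A (mat2 P Q Q R)
      = (Const (x^2) * P + Const (2 * (x * y)) * Q + Const (y^2) * R)
        + (Const (x'^2) * P + Const (2 * (x' * y')) * Q + Const (y'^2) * R)"
    by (rule poly_mapping_eqI, simp only: trace_inner_mat2 A lookup_add lookup_Const_mult)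
      (simp add: algebra_simps)
  then show ?thesis
    using sum_of_squares_add [OF assms(2) assms(2), of x y x' y'] by simp
qed

text \<open>A single square: \<open>x\<close> times \<open>power_mean 4\<close> plus
  \<open>y\<close> times the square of \<open>power_mean 2\<close>.\<close>

lemma sum_of_squares_B1:
  "sum_of_squares (Const (x^2) * p [4,4] + Const (2 * (x * y)) * p [4,2,2] + Const (y^2) * p [2,2,2,2])"
proof -
  let ?g = "Const x * power_mean 4 + Const y * (power_mean 2 * power_mean 2)"
  have "?g ^ 2 = Const (x^2) * p [4,4] + Const (2 * (x * y)) * p [4,2,2] + Const (y^2) * p [2,2,2,2]"
    by (simp add: p_def power2_eq_square Const_mult Const_numeral algebra_simps)
  moreover have "homogeneous 4 (power_mean 2 * power_mean 2)"
    by (rule homogeneous_mult_eq [OF homogeneous_power_mean homogeneous_power_mean]) simp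
  then have "homogeneous 4 ?g"
    by (intro homogeneous_add homogeneous_Const_mult homogeneous_power_mean)
  ultimately show ?thesis
    by (metis sum_of_squares_square)
qed

text \<open>The variance identity, which turns the covariances in \<open>B2\<close> into sums of
  squares.\<close>

lemma sum_power2_differences:
  fixes a :: "'i::finite \<Rightarrow> 'a::comm_ring_1"
  shows "(\<Sum>i\<in>UNIV. \<Sum>j\<in>UNIV. (a i - a j) ^ 2)
    = 2 * (of_nat CARD('i) * (\<Sum>i\<in>UNIV. a i ^ 2) - (\<Sum>i\<in>UNIV. a i) ^ 2)"
proof -
  have "(a i - a j) ^ 2 = a i ^ 2 + a j ^ 2 - 2 * (a i * a j)" for i j
    by (simp add: power2_eq_square algebra_simps)
  then have "(\<Sum>i\<in>UNIV. \<Sum>j\<in>UNIV. (a i - a j) ^ 2)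
      = (\<Sum>i\<in>UNIV. \<Sum>j\<in>(UNIV :: 'i set). a i ^ 2) + (\<Sum>i\<in>(UNIV :: 'i set). \<Sum>j\<in>UNIV. a j ^ 2)
        - 2 * (\<Sum>i\<in>UNIV. \<Sum>j\<in>UNIV. a i * a j)"
    by (simp only: sum.distrib sum_subtractf sum_distrib_left)
  also have "(\<Sum>i\<in>UNIV. \<Sum>j\<in>UNIV. a i * a j) = (\<Sum>i\<in>UNIV. a i) ^ 2"
    by (simp only: power2_eq_square sum_product)
  finally show ?thesis
    by (simp add: sum_distrib_left [symmetric] algebra_simps)
qed

lemma sum_X_power:
  "(\<Sum>i\<in>UNIV. X i ^ k) = Const (real CARD('n)) * (power_mean k :: ('n::finite) mpoly)"
  unfolding power_mean_def mult.assoc [symmetric] Const_mult [symmetric] by simp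

text \<open>The polynomial is the variance over \<open>i\<close> of \<open>h i\<close>, the
  combination of \<open>power_mean 2 * X i ^ 2\<close> and \<open>X i ^ 4\<close> with weights
  \<open>x\<close> and \<open>y\<close>.\<close>

lemma sum_of_squares_B2:
  fixes x y :: real
  shows "sum_of_squares (Const (x^2) * (p [4,2,2] - p [2,2,2,2])
    + Const (2 * (x * y)) * (p [6,2] - p [4,2,2]) + Const (y^2) * (p [8] - p [4,4]) :: ('n::finite) mpoly)"
    (is "sum_of_squares ?f")
proof -
  let ?N = "real CARD('n)"
  define P :: "nat \<Rightarrow> 'n mpoly" where "P = power_mean"
  define h where "h i = Const x * (P 2 * X i ^ 2) + Const y * X i ^ 4" for i :: 'n
  have X: "(\<Sum>i\<in>UNIV. X i ^ k) = Const ?N * P k" for k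
    unfolding P_def by (rule sum_X_power)
  have sum_h: "(\<Sum>i\<in>UNIV. h i) = Const ?N * (Const x * (P 2 * P 2) + Const y * P 4)"
    by (simp add: h_def sum.distrib sum_distrib_left [symmetric] X algebra_simps)
  have "h i ^ 2 = Const (x^2) * (P 2 * P 2) * X i ^ 4 + Const (2 * (x * y)) * P 2 * X i ^ 6
      + Const (y^2) * X i ^ 8" for i
    unfolding h_def X_power_even
    by (simp only: power2_eq_square Const_mult Const_numeral mult_2 distrib_left distrib_right mult_ac add_ac)
  then have sum_h2: "(\<Sum>i\<in>UNIV. h i ^ 2) = Const ?N * (Const (x^2) * (P 2 * P 2) * P 4
      + Const (2 * (x * y)) * P 2 * P 6 + Const (y^2) * P 8)"
    by (simp only: sum.distrib sum_distrib_left [symmetric] X) (simp only: distrib_left mult_ac)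
  have "(\<Sum>i\<in>UNIV. \<Sum>j\<in>UNIV. (h i - h j) ^ 2)
      = Const 2 * (Const ?N * (Const ?N * (Const (x^2) * (P 2 * P 2) * P 4
          + Const (2 * (x * y)) * P 2 * P 6 + Const (y^2) * P 8))
        - (Const ?N * (Const x * (P 2 * P 2) + Const y * P 4)) ^ 2)"
    unfolding sum_power2_differences sum_h sum_h2 by (simp only: Const_of_nat Const_numeral)
  also have "\<dots> = Const 2 * (Const ?N * Const ?N) * ?f"
    by (simp add: p_def P_def power2_eq_square Const_mult Const_numeral algebra_simps)
  also have "Const 2 * (Const ?N * Const ?N) = Const (2 * (?N * ?N))"
    by (simp only: Const_mult)
  finally have "Const (1 / (2 * (?N * ?N))) * (\<Sum>i\<in>UNIV. \<Sum>j\<in>UNIV. (h i - h j) ^ 2) = ?f"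
    by (simp only: mult.assoc [symmetric] Const_mult [symmetric]) simp
  moreover have "homogeneous 4 (h i - h j)" for i j
  proof -
    have "homogeneous 4 (h i)" for i
      unfolding h_def P_def
      using homogeneous_mult [OF homogeneous_power_mean [of 2] homogeneous_X_square [of i]]
        homogeneous_power [OF homogeneous_X, of 4 i]
      by (intro homogeneous_add homogeneous_Const_mult) simp_all
    then show ?thesis
      by (intro homogeneous_diff)
  qed
  then have "sum_of_squares (Const (1 / (2 * (?N * ?N))) * (\<Sum>i\<in>UNIV. \<Sum>j\<in>UNIV. (h i - h j) ^ 2))"
    by (intro sum_of_squares_Const_mult sum_of_squares_sum sum_of_squares_square) simp_all
  ultimately show ?thesis
    by simp
qed

lemma sum_of_squares_B4:
  fixes x y :: real
  assumes card: "CARD('n::finite) \<ge> 4"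
  defines "N \<equiv> real CARD('n)"
  shows "sum_of_squares (Const (x^2) * (p [2,2,2,2] - Const (1 / N) * p [4,2,2])
    + Const (2 * (x * y)) * (2 * p [4,2,2] - Const (2 / N) * p [6,2])
    + Const (y^2) * (2 * p [6,2] + 2 * p [4,4] - Const (4 / N) * p [8]) :: 'n mpoly)"
    (is "sum_of_squares ?f")
proof -
  obtain A :: "'n set" where "card A = 2"
    using card obtain_subset_with_card_n [of 2 "UNIV :: 'n set"] by auto
  then obtain a b :: 'n where ab: "a \<noteq> b"
    by (auto simp: card_2_iff)
  have N: "N \<ge> 4"
    using card by (simp add: N_def)
  \<comment> \<open>These weights give \<open>g = x / N\<close>, \<open>s = y\<close>,
    \<open>t = 0\<close> and \<open>e = 0\<close> in \<open>pair_part_decomposition\<close>, so only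
    the \<open>B4\<close> term for the vector \<open>(x, y)\<close> survives.\<close>
  define v where "v k = x / N + (if k = a then y else 0) + (if k = b then y else 0)" for k
  have sum_v: "(\<Sum>k\<in>UNIV. v k) = x + 2 * y"
    using N by (simp add: v_def sum.distrib N_def)
  have v: "v a = x / N + y" "v b = x / N + y" "v k = x / N" if "k \<in> - {a, b}" for k
    using ab that by (auto simp: v_def)
  have va: "v a = x / N + y" "v b = x / N + y"
    using ab by (auto simp: v_def)
  let ?h = "X a * X b * (\<Sum>k\<in>UNIV. Const (v k) * X k ^ 2)"
  have g: "((\<Sum>k\<in>UNIV. v k) - v a - v b) / (N - 2) = x / N"
    using N unfolding sum_v va by (simp add: field_simps)
  have "?f = Const ((N - 1) / N) * reynolds (?h ^ 2)"
  proof (rule poly_mapping_eqI)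
    fix m :: "'n \<Rightarrow>\<^sub>0 nat"
    obtain \<alpha> \<beta> \<gamma> \<epsilon> \<zeta> where S: "quad_coeff m = pattern \<alpha> \<beta> \<gamma> \<epsilon> \<zeta>"
      by (rule quad_coeff_obtain_pattern [OF card])
    have s: "(v a + v b) / 2 - x / N = y" "v a - v b = 0"
      unfolding va by (simp_all add: field_simps)
    have e: "(\<Sum>k\<in>- {a, b}. (v k - x / N)^2) = 0"
      by (rule sum.neutral) (simp add: v)
    have "Poly_Mapping.lookup (reynolds (?h ^ 2)) m
      = N / (N - 1) * (x^2 * (mean2222 (quad_coeff m) - 1 / N * mean422 (quad_coeff m))
          + 2 * (x * y) * (2 * mean422 (quad_coeff m) - 2 / N * mean62 (quad_coeff m))
          + y^2 * (2 * mean62 (quad_coeff m) + 2 * mean44 (quad_coeff m) - 4 / N * mean8 (quad_coeff m)))"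
      unfolding lookup_reynolds_pair_part pair_part_decomposition [OF card ab S, of v]
        N_def [symmetric] g s e using N by simp
    then show "Poly_Mapping.lookup ?f m = Poly_Mapping.lookup (Const ((N - 1) / N) * reynolds (?h ^ 2)) m"
      using N by (simp only: lookup_add lookup_minus lookup_Const_mult lookup_two_mult lookup_p) simp
  qed
  moreover have "homogeneous 2 (\<Sum>k\<in>UNIV. Const (v k) * X k ^ 2)"
    by (intro homogeneous_sum homogeneous_Const_mult homogeneous_X_square)
  then have "homogeneous 4 ?h"
    by (rule homogeneous_mult_eq [OF homogeneous_mult [OF homogeneous_X homogeneous_X]]) simp
  ultimately show ?thesis
    by (rule sum_of_squares_scaled_reynolds_square) (use N in simp)
qed

lemma reynolds_two_mult: "reynolds (2 * f) = 2 * reynolds f"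
  using reynolds_Const_mult [of 2 f] by (simp only: Const_numeral)

text \<open>Each generator is a positive multiple of one averaged square. In pattern coefficients,
  the squares of \<open>?g3\<close>, \<open>?g5\<close>, \<open>?g6\<close> and \<open>?g7\<close>
  average to 4\<gamma>, 2(\<beta> + \<epsilon> - \<gamma>), \<alpha> and 2\<beta>.\<close>

lemma sum_of_squares_B3_B5_B6_B7:
  assumes card: "CARD('n::finite) \<ge> 4"
  shows "sum_of_squares (B3 :: 'n mpoly)" "sum_of_squares (B5 :: 'n mpoly)"
    "sum_of_squares (B6 :: 'n mpoly)" "sum_of_squares (B7 :: 'n mpoly)"
proof -
  define N where "N = real CARD('n)"
  have N: "N \<ge> 4"
    using card by (simp add: N_def)
  define K where "K = (N - 1) * (N - 2) * (N - 3) / N^3"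
  have K: "K > 0"
    unfolding K_def using N by (intro divide_pos_pos mult_pos_pos) auto
  obtain A :: "'n set" where "card A = 4"
    using card obtain_subset_with_card_n by metis
  then obtain xs :: "'n list" where "distinct xs" "length xs = 4"
    by (metis card.infinite distinct_card finite_distinct_list zero_neq_numeral)
  then obtain a b c d :: 'n where dist: "distinct [a, b, c, d]"
    by (auto simp: length_Suc_conv numeral_eq_Suc)
  \<comment> \<open>Keeping the squared variables opaque leaves expanded squares as right-nested
    products of four factors, the shape matched by \<open>quad\<close>.\<close>
  define Y :: "'n \<Rightarrow> 'n mpoly" where "Y i = X i ^ 2" for i
  have quad: "reynolds (Y i * (Y j * (Y k * Y l))) = quad i j k l" for i j k l
    by (simp only: quad_def Y_def mult.assoc)
  have hom_Y: "homogeneous 2 (Y i)" for i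
    unfolding Y_def by (rule homogeneous_X_square)
  have hom_XX: "homogeneous 2 (X i * X j)" for i j :: 'n
    by (rule homogeneous_mult_eq [OF homogeneous_X homogeneous_X]) simp
  have lookup_B: "Poly_Mapping.lookup (B3 :: 'n mpoly) m = K * \<gamma>"
    "Poly_Mapping.lookup (B5 :: 'n mpoly) m = (N - 1) / N * (\<beta> + \<epsilon> - \<gamma>)"
    "Poly_Mapping.lookup (B6 :: 'n mpoly) m = K * \<alpha>"
    "Poly_Mapping.lookup (B7 :: 'n mpoly) m = K * \<beta>"
    if S: "quad_coeff m = pattern \<alpha> \<beta> \<gamma> \<epsilon> \<zeta>" for m \<alpha> \<beta> \<gamma> \<epsilon> \<zeta>
  proof -
    show "Poly_Mapping.lookup (B3 :: 'n mpoly) m = K * \<gamma>"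
      "Poly_Mapping.lookup (B6 :: 'n mpoly) m = K * \<alpha>"
      "Poly_Mapping.lookup (B7 :: 'n mpoly) m = K * \<beta>"
      by (simp_all only: B3_def B6_def B7_def Let_def lookup_add lookup_minus lookup_Const_mult
        lookup_two_mult lookup_p S mean_pattern_combinations K_def N_def)
    show "Poly_Mapping.lookup (B5 :: 'n mpoly) m = (N - 1) / N * (\<beta> + \<epsilon> - \<gamma>)"
      using N by (simp only: B5_def lookup_minus lookup_p S mean_pattern N_def [symmetric])
        (simp add: field_simps)
  qed
  have scale: "f = Const r * g"
    if "\<And>m \<alpha> \<beta> \<gamma> \<epsilon> \<zeta>. quad_coeff m = pattern \<alpha> \<beta> \<gamma> \<epsilon> \<zeta>
      \<Longrightarrow> Poly_Mapping.lookup f m = r * Poly_Mapping.lookup g m" for f g :: "'n mpoly" and r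
  proof (rule poly_mapping_eqI)
    fix m :: "'n \<Rightarrow>\<^sub>0 nat"
    obtain \<alpha> \<beta> \<gamma> \<epsilon> \<zeta> where "quad_coeff m = pattern \<alpha> \<beta> \<gamma> \<epsilon> \<zeta>"
      by (rule quad_coeff_obtain_pattern [OF card])
    then show "Poly_Mapping.lookup f m = Poly_Mapping.lookup (Const r * g) m"
      using that by simp
  qed
  note lookup_simps = reynolds_add reynolds_diff reynolds_two_mult reynolds_Const_mult quad lookup_add lookup_minus
    lookup_two_mult quad_coeff_def [symmetric]
  let ?g3 = "(Y a - Y b) * (Y c - Y d)"
  \<comment> \<open>The factor 4 is written with \<open>Const\<close> so that
    \<open>reynolds_Const_mult\<close> can pull it out.\<close>
  have g3: "?g3 ^ 2 = Y a * (Y a * (Y c * Y c)) - 2 * (Y a * (Y a * (Y c * Y d))) + Y a * (Y a * (Y d * Y d))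
      - 2 * (Y a * (Y b * (Y c * Y c))) + Const 4 * (Y a * (Y b * (Y c * Y d))) - 2 * (Y a * (Y b * (Y d * Y d)))
      + Y b * (Y b * (Y c * Y c)) - 2 * (Y b * (Y b * (Y c * Y d))) + Y b * (Y b * (Y d * Y d))"
    by (simp add: Const_numeral power2_eq_square algebra_simps)
  have "(B3 :: 'n mpoly) = Const (K / 4) * reynolds (?g3 ^ 2)"
    by (rule scale) (use dist in \<open>simp add: lookup_B, simp add: g3 lookup_simps pattern_def\<close>)
  moreover have "homogeneous 4 ?g3"
    using homogeneous_mult [OF homogeneous_diff homogeneous_diff, OF hom_Y hom_Y hom_Y hom_Y] by simp
  ultimately show "sum_of_squares (B3 :: 'n mpoly)"
    by (rule sum_of_squares_scaled_reynolds_square) (use K in simp)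
  have ba: "b \<noteq> a"
    using dist by auto
  let ?g5 = "(X a * X b) * (Y a - Y b)"
  have g5: "?g5 ^ 2 = Y a * (Y b * (Y a * Y a)) - 2 * (Y a * (Y b * (Y a * Y b))) + Y a * (Y b * (Y b * Y b))"
    by (simp add: Y_def power2_eq_square algebra_simps)
  have "(B5 :: 'n mpoly) = Const ((N - 1) / N / 2) * reynolds (?g5 ^ 2)"
    by (rule scale) (use dist N ba in \<open>simp add: lookup_B, simp add: g5 lookup_simps pattern_def, simp add: field_simps\<close>)
  moreover have "homogeneous 4 ?g5"
    using homogeneous_mult [OF hom_XX homogeneous_diff, OF hom_Y hom_Y] by simp
  ultimately show "sum_of_squares (B5 :: 'n mpoly)"
    by (rule sum_of_squares_scaled_reynolds_square) (use N in simp)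
  let ?g6 = "(X a * X b) * (X c * X d)"
  have g6: "?g6 ^ 2 = Y a * (Y b * (Y c * Y d))"
    by (simp add: Y_def power2_eq_square algebra_simps)
  have "(B6 :: 'n mpoly) = Const K * reynolds (?g6 ^ 2)"
    by (rule scale) (use dist in \<open>simp add: lookup_B, simp add: g6 lookup_simps pattern_def\<close>)
  moreover have "homogeneous 4 ?g6"
    using homogeneous_mult [OF hom_XX hom_XX] by simp
  ultimately show "sum_of_squares (B6 :: 'n mpoly)"
    by (rule sum_of_squares_scaled_reynolds_square) (use K in simp)
  let ?g7 = "(X a * X b) * (Y c - Y d)"
  have g7: "?g7 ^ 2 = Y a * (Y b * (Y c * Y c)) - 2 * (Y a * (Y b * (Y c * Y d))) + Y a * (Y b * (Y d * Y d))"
    by (simp add: Y_def power2_eq_square algebra_simps)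
  have "(B7 :: 'n mpoly) = Const (K / 2) * reynolds (?g7 ^ 2)"
    by (rule scale) (use dist in \<open>simp add: lookup_B, simp add: g7 lookup_simps pattern_def\<close>)
  moreover have "homogeneous 4 ?g7"
    using homogeneous_mult [OF hom_XX homogeneous_diff, OF hom_Y hom_Y] by simp
  ultimately show "sum_of_squares (B7 :: 'n mpoly)"
    by (rule sum_of_squares_scaled_reynolds_square) (use K in simp)
qed

lemma octic_cone_sum_of_squares:
  fixes f :: "('n::finite) mpoly"
  assumes card: "CARD('n) \<ge> 4" and "f \<in> octic_cone"
  shows "sum_of_squares f"
proof -
  obtain A1 A2 A4 A3 A5 A6 A7 where f: "f = octic_combination A1 A2 A4 A3 A5 A6 A7"
    and A: "psd A1" "psd A2" "psd A4" "A3 \<ge> 0" "A5 \<ge> 0" "A6 \<ge> 0" "A7 \<ge> 0"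
    using assms(2) unfolding octic_cone_def by blast
  show ?thesis
    unfolding f octic_combination_def B1_def B2_def B4_def Let_def
    by (intro sum_of_squares_add sum_of_squares_trace_inner sum_of_squares_Const_mult
        sum_of_squares_B1 sum_of_squares_B2 sum_of_squares_B4 sum_of_squares_B3_B5_B6_B7 card A)
qed

theorem theorem4p15:
  fixes f :: "('n::finite) mpoly"
  assumes "CARD('n) \<ge> 4"
    and "f \<in> even_symmetric_forms 8"
  shows "sum_of_squares f \<longleftrightarrow>
    (\<exists>(A1 :: real ^ 2 ^ 2) (A2 :: real ^ 2 ^ 2) (A4 :: real ^ 2 ^ 2)
       (A3 :: real) (A5 :: real) (A6 :: real) (A7 :: real).
       psd A1 \<and> psd A2 \<and> psd A4 \<and> A3 \<ge> 0 \<and> A5 \<ge> 0 \<and> A6 \<ge> 0 \<and> A7 \<ge> 0 \<and>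
       f = trace_inner A1 B1 + trace_inner A2 B2 + Const A3 * B3 + trace_inner A4 B4
           + Const A5 * B5 + Const A6 * B6 + Const A7 * B7)"
proof -
  have "sum_of_squares f \<longleftrightarrow> f \<in> octic_cone"
    using sum_of_squares_in_octic_cone octic_cone_sum_of_squares assms by blast
  then show ?thesis
    unfolding octic_cone_def octic_combination_def by blast
qed

end
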